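(* The family $(\mathbb{D},\mathbb{G}_\beta)_{\beta\in N_0}$, where $N_0=\{\beta\in 2^\omega\mid\beta(0)=0\}$, is a $\sqsubseteq_c$-antichain of size continuum (for $\beta\neq\beta'$ in $N_0$, $(\mathbb{D},\mathbb{G}_\beta)$ and $(\mathbb{D},\mathbb{G}_{\beta'})$ are $\sqsubseteq_c$-incomparable) made of locally countable Borel graphs on $\mathbb{D}$ which are $\sqsubseteq_c$-minimal among non-$\mathbf{\Sigma}^0_2$ graphs on an analytic space.
   Context: A relation on $X$ is a subset of $X^2$; it is locally countable if all its horizontal and vertical sections are countable. A graph is a symmetric relation disjoint from the diagonal. $(X,A)\sqsubseteq_c(Y,B)$ means there is an injective continuous $f:X\to Y$ with $A=(f\times f)^{-1}(B)$. An analytic space is a separable metrizable space homeomorphic to an analytic subset of a Polish space. A relation $R$ on $X$ is non-$\mathbf{\Sigma}^0_2$ if it is not a $\mathbf{\Sigma}^0_2$ subset of $X^2$. $(Y,B)$ is $\sqsubseteq_c$-minimal among a class of pairs if it belongs to the class and every $(X,R)$ in the class with $(X,R)\sqsubseteq_c(Y,B)$ satisfies $(Y,B)\sqsubseteq_c(X,R)$. Let $\mathbb{D}=2\times 2^\omega$, $\mathbb{C}=\mathbb{P}_\infty:=\{\alpha\in 2^\omega\mid\alpha(n)=1\text{ for infinitely many }n\}$, $\Delta(\mathbb{C})=\{(x,x)\mid x\in\mathbb{C}\}$. Let $Q=\{\emptyset\}\cup\{u1\mid u\in 2^{<\omega}\}$ (finite binary sequences that are empty or end with $1$). For $z\in 2^{<\omega}\setminus\{\emptyset\}$,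 $z^-:=z|\max\{l<|z|\mid z|l\in Q\}$ (its longest proper initial segment in $Q$). $\leq_{\text{lex}}$ is the lexicographic order on $2^{<\omega}$ (a proper initial segment precedes its extensions). Let $\perp_<$ be the set of $(z,t)\in Q^2$ for which there is $i<\min(|z|,|t|)$ with $z|i=t|i$ and $z(i)<t(i)$. Define $i:Q^2\to\omega$ by induction on $\max(|z|,|t|)$ (a clause mentioning $z^-$, resp. $t^-$, requires $z\neq\emptyset$, resp. $t\neq\emptyset$): - $i(z,t)=0$ if $z=t$; - $i(z,t)=i(z,t^-)$ if $|z|<|t^-|$, or $|z|=|t^-|$ and $(z,t^-)\in\perp_<$; - $i(z,t)=i(z,t^-)+1$ if ($|z|<|t|$ and $|z|>|t^-|$), or ($|z|=|t^-|$ and $(z,t^-)\notin\perp_<$); - $i(z,t)=i(z^-,t)$ if $|t|<|z^-|$, or $|t|=|z^-|$ and $(t,z^-)\in\perp_<$; - $i(z,t)=i(z^-,t)+1$ if ($|t|<|z|$ and $|t|>|z^-|$), or ($|t|=|z^-|$ and $(t,z^-)\notin\perp_<$); - $i(z,t)=i(z^-,t^-)+1$ if $|z|=|t|$ and [($|z^-|<|t^-|$ and $t^-<_{\text{lex}}z^-$) or ($|t^-|<|z^-|$ and $z^-<_{\text{lex}}t^-$)]; - $i(z,t)=i(z^-,t^-)+2$ if $|z|=|t|$ and [($|z^-|<|t^-|$ and $z^-<_{\text{lex}}t^-$) or ($|t^-|<|z^-|$ and $t^-<_{\text{lex}}z^-$) or ($|z^-|=|t^-|$ and $z^-\neq t^-$)].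 For $\beta\in 2^\omega$, $\mathbb{R}_\beta=\Delta(\mathbb{C})\cup\bigcup_{p\in\omega,\ \beta(p)=1}\{(z0^\infty,t0^\infty)\mid z\neq t\in Q,\ i(z,t)=p\}$, and $\mathbb{G}_\beta$ is the symmetrization $E\cup E^{-1}$ of $E=\{((0,\alpha),(1,\gamma))\in\mathbb{D}^2\mid(\alpha,\gamma)\in\mathbb{R}_\beta\}$. *)

theory Defs
  imports "HOL-Analysis.Analysis"
begin

section \<open>Polish and analytic spaces\<close>

definition Polish_space :: "'a topology \<Rightarrow> bool" where
  "Polish_space X \<longleftrightarrow> separable_space X \<and> completely_metrizable_space X"

text \<open>Here \<^term>\<open>euclidean :: (nat \<Rightarrow> nat) topology\<close> is the Baire space.\<close>

definition analytic_in :: "'a topology \<Rightarrow> 'a set \<Rightarrow> bool" where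
  "analytic_in X A \<longleftrightarrow>
     A = {} \<or> (\<exists>f. continuous_map (euclidean :: (nat \<Rightarrow> nat) topology) X f \<and> range f = A)"

text \<open>
  One cannot quantify existentially over types, so the ambient Polish space is taken with its
  points in \<^typ>\<open>nat \<Rightarrow> bool\<close>. This is no restriction: a Polish space has at most continuum many
  points, and its topology (\<open>P\<close> is an arbitrary one, unrelated to the product topology) can be
  transported along any injection into \<^typ>\<open>nat \<Rightarrow> bool\<close>.
\<close>

definition analytic_space :: "'a topology \<Rightarrow> bool" where
  "analytic_space X \<longleftrightarrow>
     separable_space X \<and> metrizable_space X \<and>
     (\<exists>(P :: (nat \<Rightarrow> bool) topology) A.
        Polish_space P \<and> A \<subseteq> topspace P \<and> analytic_in P A \<and>
        X homeomorphic_space subtopology P A)"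


section \<open>Relations and graphs on topological spaces\<close>

definition graph_on :: "'a topology \<Rightarrow> ('a \<times> 'a) set \<Rightarrow> bool" where
  "graph_on X R \<longleftrightarrow> R \<subseteq> topspace X \<times> topspace X \<and> sym R \<and> R \<inter> Id = {}"

definition locally_countable :: "('a \<times> 'a) set \<Rightarrow> bool" where
  "locally_countable R \<longleftrightarrow>
     (\<forall>x. countable {y. (x, y) \<in> R}) \<and> (\<forall>y. countable {x. (x, y) \<in> R})"

definition embeds_c ::
    "'a topology \<Rightarrow> ('a \<times> 'a) set \<Rightarrow> 'b topology \<Rightarrow> ('b \<times> 'b) set \<Rightarrow> bool" where
  "embeds_c X A Y B \<longleftrightarrow>
     (\<exists>f. continuous_map X Y f \<and> inj_on f (topspace X) \<and>
          A = {(x, y) \<in> topspace X \<times> topspace X. (f x, f y) \<in> B})"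

text \<open>In a metrizable space, \<open>\<Sigma>\<^sup>0\<^sub>2\<close> means \<open>F\<^sub>\<sigma>\<close>.\<close>

definition non_Sigma02_graph :: "'a topology \<Rightarrow> ('a \<times> 'a) set \<Rightarrow> bool" where
  "non_Sigma02_graph X R \<longleftrightarrow>
     analytic_space X \<and> graph_on X R \<and> \<not> fsigma_in (prod_topology X X) R"

text \<open>
  The type argument is the carrier type of the competitors \<open>(X, R)\<close>. Minimality among all
  analytic spaces is this property for every type \<open>'a\<close>, so \<open>'a\<close> must be left as a type variable.
\<close>

definition minimal_non_Sigma02_graph ::
    "'a itself \<Rightarrow> 'b topology \<Rightarrow> ('b \<times> 'b) set \<Rightarrow> bool" where
  "minimal_non_Sigma02_graph (_ :: 'a itself) Y B \<longleftrightarrow>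
     non_Sigma02_graph Y B \<and>
     (\<forall>(X :: 'a topology) R.
        non_Sigma02_graph X R \<and> embeds_c X R Y B \<longrightarrow> embeds_c Y B X R)"


section \<open>The graphs\<close>

text \<open>
  The set \<open>2 = {0, 1}\<close> is \<^typ>\<open>bool\<close>, with \<open>0\<close> as \<^const>\<open>False\<close>, and it is discrete; \<open>2\<^sup>\<omega>\<close> is
  \<^typ>\<open>nat \<Rightarrow> bool\<close> with the product topology, and finite binary sequences are boolean lists.
\<close>

type_synonym cantor = "nat \<Rightarrow> bool"

abbreviation D_space :: "(bool \<times> cantor) topology" where
  "D_space \<equiv> euclidean"

definition P_infinity :: "cantor set" where
  "P_infinity = {\<alpha>. infinite {n. \<alpha> n}}"

definition Q :: "bool list set" where
  "Q = {[]} \<union> {u @ [True] | u. True}"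

definition pred_Q :: "bool list \<Rightarrow> bool list" where
  "pred_Q z = take (Max {l. l < length z \<and> take l z \<in> Q}) z"

definition lex_less :: "bool list \<Rightarrow> bool list \<Rightarrow> bool" where
  "lex_less z t \<longleftrightarrow> (z, t) \<in> lexord {(a, b). a < b}"

definition perp_less :: "(bool list \<times> bool list) set" where
  "perp_less = {(z, t) \<in> Q \<times> Q.
     \<exists>i < min (length z) (length t). take i z = take i t \<and> z ! i < t ! i}"

lemma length_pred_Q: "z \<noteq> [] \<Longrightarrow> length (pred_Q z) < length z"
proof -
  assume "z \<noteq> []"
  let ?L = "{l. l < length z \<and> take l z \<in> Q}"
  have "0 \<in> ?L" using \<open>z \<noteq> []\<close> by (simp add: Q_def)
  moreover have "finite ?L" by simp
  ultimately have "Max ?L \<in> ?L" by (intro Max_in) auto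
  then show ?thesis by (simp add: pred_Q_def)
qed

text \<open>
  The conditions are mutually exclusive, and on \<open>Q \<times> Q\<close> they are exhaustive; the last value is
  never reached there.
\<close>

function idx :: "bool list \<Rightarrow> bool list \<Rightarrow> nat" where
  "idx z t =
    (if z = t then 0
     else if t \<noteq> [] \<and>
       (length z < length (pred_Q t) \<or>
        length z = length (pred_Q t) \<and> (z, pred_Q t) \<in> perp_less)
     then idx z (pred_Q t)
     else if t \<noteq> [] \<and>
       (length z < length t \<and> length z > length (pred_Q t) \<or>
        length z = length (pred_Q t) \<and> (z, pred_Q t) \<notin> perp_less)
     then idx z (pred_Q t) + 1
     else if z \<noteq> [] \<and>
       (length t < length (pred_Q z) \<or>
        length t = length (pred_Q z) \<and> (t, pred_Q z) \<in> perp_less)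
     then idx (pred_Q z) t
     else if z \<noteq> [] \<and>
       (length t < length z \<and> length t > length (pred_Q z) \<or>
        length t = length (pred_Q z) \<and> (t, pred_Q z) \<notin> perp_less)
     then idx (pred_Q z) t + 1
     else if z \<noteq> [] \<and> t \<noteq> [] \<and> length z = length t \<and>
       (length (pred_Q z) < length (pred_Q t) \<and> lex_less (pred_Q t) (pred_Q z) \<or>
        length (pred_Q t) < length (pred_Q z) \<and> lex_less (pred_Q z) (pred_Q t))
     then idx (pred_Q z) (pred_Q t) + 1
     else if z \<noteq> [] \<and> t \<noteq> [] \<and> length z = length t \<and>
       (length (pred_Q z) < length (pred_Q t) \<and> lex_less (pred_Q z) (pred_Q t) \<or>
        length (pred_Q t) < length (pred_Q z) \<and> lex_less (pred_Q t) (pred_Q z) \<or>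
        length (pred_Q z) = length (pred_Q t) \<and> pred_Q z \<noteq> pred_Q t)
     then idx (pred_Q z) (pred_Q t) + 2
     else 0)"
  by pat_completeness auto
termination
  by (relation "Wellfounded.measure (\<lambda>(z, t). length z + length t)")
     (auto dest: length_pred_Q intro: add_strict_mono length_pred_Q)

declare idx.simps [simp del]

definition zeros_ext :: "bool list \<Rightarrow> cantor" where
  "zeros_ext z = (\<lambda>n. n < length z \<and> z ! n)"

definition R_rel :: "cantor \<Rightarrow> (cantor \<times> cantor) set" where
  "R_rel \<beta> = {(x, x) | x. x \<in> P_infinity} \<union>
     (\<Union>p \<in> {p. \<beta> p}. {(zeros_ext z, zeros_ext t) | z t.
        z \<in> Q \<and> t \<in> Q \<and> z \<noteq> t \<and> idx z t = p})"

definition E_rel :: "cantor \<Rightarrow> ((bool \<times> cantor) \<times> (bool \<times> cantor)) set" where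
  "E_rel \<beta> = {((False, \<alpha>), (True, \<gamma>)) | \<alpha> \<gamma>. (\<alpha>, \<gamma>) \<in> R_rel \<beta>}"

definition G_graph :: "cantor \<Rightarrow> ((bool \<times> cantor) \<times> (bool \<times> cantor)) set" where
  "G_graph \<beta> = E_rel \<beta> \<union> (E_rel \<beta>)\<inverse>"

definition N0 :: "cantor set" where
  "N0 = {\<beta>. \<not> \<beta> 0}"

end

theory Submission
  imports Defs
begin

text \<open>
  The argument rests on reading the index of two elements of \<open>Q\<close> as a count. Order \<open>Q\<close> by length,
  and sequences of the same length lexicographically; this order has type \<open>\<omega>\<close>. Every
  \<open>z \<in> Q\<close> has the finite chain of its ancestors, the initial segments of \<open>z\<close> that lie in \<open>Q\<close>. Given
  \<open>z\<close> and \<open>t\<close>, discard the common ancestors and list the others in increasing order, each marked by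
  the sequence it comes from: the index is the number of maximal runs of equal marks. Indeed each
  clause of the definition removes the largest ancestors that are left, and pays when the mark
  changes (\<open>idx_prec\<close>). Hence the index is preserved by any map of \<open>Q\<close> to itself that extends
  the image of the parent by ancestors occupying a block of lengths beyond all lengths used for
  smaller sequences: a run is replaced by a longer run (\<open>idx_spread\<close>).

  Such maps can be found inside every non-\<open>\<Sigma>\<^sup>0\<^sub>2\<close> situation. Let \<open>Z\<close> be metrizable, a continuous image
  of a closed subset of the Baire space, and let \<open>h\<^sub>j\<close> be finitely many continuous maps from \<open>Z\<close> to
  \<open>2\<^sup>\<omega>\<close> for which the preimage of \<open>P\<^sub>\<infinity>\<close> is the same set \<open>D\<close>. If \<open>D\<close> is not \<open>F\<^sub>\<sigma>\<close>, Hurewicz's argument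
  produces a Cantor set in \<open>Z\<close> meeting the complement of \<open>D\<close> in a countable dense subset. The points
  of this dense subset are chosen one after the other, along the order of \<open>Q\<close>, and each of them may be
  chosen as close to its parent as desired. Closeness to the parent makes the codes of the images
  under all \<open>h\<^sub>j\<close> extend the code of the image of the parent by late ones only, so the Cantor set can
  be arranged such that every \<open>h\<^sub>j\<close> preserves the index on it (\<open>cantor_copy\<close>).

  For minimality, let a graph \<open>R\<close> on \<open>X\<close> be reduced to \<open>G\<^sub>\<beta>\<close> by \<open>f\<close>. Outside a countable set, the pairs
  in \<open>R\<close> are mapped to pairs of the form \<open>((0,\<alpha>),(1,\<alpha>))\<close> or its reverse; thus the pairs of the first
  form with \<open>\<alpha> \<in> P\<^sub>\<infinity>\<close> form a set which is not \<open>F\<^sub>\<sigma>\<close>. With \<open>h(x,y) = \<alpha>\<close> one gets a Cantor set of pairs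
  \<open>(x,y)\<close>, and sending \<open>(0,\<cdot>)\<close> to its first and \<open>(1,\<cdot>)\<close> to its second coordinates reduces \<open>G\<^sub>\<beta>\<close> to \<open>R\<close>,
  since a map preserving \<open>P\<^sub>\<infinity>\<close> and the index preserves \<open>R\<^sub>\<beta>\<close> in both directions
  (\<open>faithful_R_rel\<close>, \<open>G_graph_minimal\<close>).

  For incomparability, let \<open>f\<close> reduce \<open>G\<^sub>\<beta>\<close> to \<open>G\<^sub>\<beta>\<^sub>'\<close>. The same construction is applied to two maps at
  once, the position of a vertical pair in the domain and the position of its image. Two elements
  of \<open>Q\<close> with index \<open>p\<close> then yield a pair whose membership in \<open>G\<^sub>\<beta>\<close> is decided by \<open>\<beta>(p)\<close> and whose
  image is in \<open>G\<^sub>\<beta>\<^sub>'\<close> according to \<open>\<beta>'(p)\<close>. As every \<open>p > 0\<close> is an index, \<open>\<beta> = \<beta>'\<close>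
  (\<open>G_graph_antichain\<close>).
\<close>

section \<open>The tree of binary sequences ending in one\<close>

lemma Q_iff: "z \<in> Q \<longleftrightarrow> z = [] \<or> last z"
  by (cases z rule: rev_cases) (auto simp: Q_def)

lemma pred_Q_append_zeros_one:
  assumes "p \<in> Q"
  shows "pred_Q (p @ replicate m False @ [True]) = p"
proof -
  let ?z = "p @ replicate m False @ [True]"
  have "Max {l. l < length ?z \<and> take l ?z \<in> Q} = length p"
  proof (rule Max_eqI)
    show "length p \<in> {l. l < length ?z \<and> take l ?z \<in> Q}" using assms by simp
    fix l assume "l \<in> {l. l < length ?z \<and> take l ?z \<in> Q}"
    then have l: "l \<le> length p + m" "take l ?z \<in> Q" by auto
    show "l \<le> length p"
    proof (rule ccontr)
      assume "\<not> l \<le> length p"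
      then have "take l ?z = p @ replicate (l - length p) False" "0 < l - length p" using l(1) by auto
      then show False using l(2) by (simp add: Q_iff)
    qed
  qed simp
  then show ?thesis by (simp add: pred_Q_def)
qed

text \<open>
  Elements of \<open>Q\<close> other than the empty sequence are \<open>p 0\<^sup>m 1\<close> with \<open>p\<close> the predecessor: cut off the last
  one and then the zeros before it.
\<close>
lemma Q_decompose:
  assumes "z \<in> Q" "z \<noteq> []"
  obtains m where "z = pred_Q z @ replicate m False @ [True]" "pred_Q z \<in> Q"
proof -
  have trailing: "\<exists>p m. p \<in> Q \<and> u = p @ replicate m False" for u
  proof (induction u rule: rev_induct)
    case Nil
    then show ?case by (simp add: Q_iff)
  next
    case (snoc b u)
    then obtain p m where p: "p \<in> Q" "u = p @ replicate m False" by blast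
    show ?case
    proof (cases b)
      case True
      then have "u @ [b] = (u @ [b]) @ replicate 0 False" "u @ [b] \<in> Q" by (auto simp: Q_iff)
      then show ?thesis by blast
    next
      case False
      then have "u @ [b] = p @ replicate (Suc m) False" using p(2) by (simp add: replicate_append_same)
      then show ?thesis using p(1) by blast
    qed
  qed
  obtain u where "z = u @ [True]" using assms by (auto simp: Q_def)
  moreover obtain p m where "p \<in> Q" "u = p @ replicate m False" using trailing by blast
  ultimately show ?thesis using that pred_Q_append_zeros_one[of p m] by auto
qed

lemma pred_Q_in_Q [simp]: "z \<in> Q \<Longrightarrow> z \<noteq> [] \<Longrightarrow> pred_Q z \<in> Q"
  using Q_decompose by metis

lemma nth_pred_Q: "n < length (pred_Q z) \<Longrightarrow> pred_Q z ! n = z ! n"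
  by (simp add: pred_Q_def)

lemma nth_Q_after_pred_Q:
  assumes "z \<in> Q" "length (pred_Q z) \<le> n" "n < length z"
  shows "z ! n \<longleftrightarrow> n = length z - 1"
proof -
  have "z \<noteq> []" using assms by auto
  obtain m where m: "z = pred_Q z @ replicate m False @ [True]" using Q_decompose[OF assms(1) \<open>z \<noteq> []\<close>] .
  then have len: "length z = length (pred_Q z) + m + 1" by (metis add.assoc length_append length_replicate list.size(3,4) plus_nat.add_0 add.commute Suc_eq_plus1)
  have "z ! n = (replicate m False @ [True]) ! (n - length (pred_Q z))"
    using m assms(2) by (metis nth_append leD)
  then show ?thesis using len assms by (auto simp: nth_append nth_Cons split: nat.splits)
qed

text \<open>
  Length first, then lexicographic. Each element has finitely many predecessors, so constructions
  along this order may ask for bounds exceeding everything chosen before.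
\<close>
definition prec :: "bool list \<Rightarrow> bool list \<Rightarrow> bool" (infix "\<sqsubset>" 50) where
  "z \<sqsubset> t \<longleftrightarrow> length z < length t \<or> length z = length t \<and> lex_less z t"

lemma lex_less_iff:
  "lex_less z t \<longleftrightarrow> length z < length t \<and> (\<forall>k<length z. z ! k = t ! k) \<or>
     (\<exists>i<min (length z) (length t). (\<forall>k<i. z ! k = t ! k) \<and> \<not> z ! i \<and> t ! i)"
proof -
  have *: "take i z = take i t \<longleftrightarrow> (\<forall>k<i. z ! k = t ! k)" if "i < min (length z) (length t)" for i
    using that by (auto simp: list_eq_iff_nth_eq)
  have **: "take (length z) t = z \<longleftrightarrow> (\<forall>k<length z. z ! k = t ! k)" if "length z < length t"
    using that by (auto simp: list_eq_iff_nth_eq)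
  show ?thesis
    unfolding lex_less_def lexord_take_index_conv using * ** by (auto simp del: min_less_iff_conj)
qed

lemma perp_less_iff:
  assumes "length z = length t" "z \<in> Q" "t \<in> Q"
  shows "(z, t) \<in> perp_less \<longleftrightarrow> lex_less z t"
proof -
  have *: "take i z = take i t \<longleftrightarrow> (\<forall>k<i. z ! k = t ! k)" if "i < min (length z) (length t)" for i
    using that by (auto simp: list_eq_iff_nth_eq)
  show ?thesis unfolding lex_less_iff perp_less_def using assms * by (auto simp: less_bool_def)
qed

lemma prec_lenlex: "z \<sqsubset> t \<longleftrightarrow> (z, t) \<in> lenlex {(False, True)}"
proof -
  have "{(a, b). a < b} = {(False, True)}" by (auto simp: less_bool_def)
  then show ?thesis by (auto simp: prec_def lex_less_def lenlex_conv lexord_lex)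
qed

lemma wf_prec: "wf {(y, z). y \<sqsubset> z}"
proof -
  have "wf {(False, True)}" by (rule wf_insert[THEN iffD2]) (auto dest: )
  then have "wf (lenlex {(False, True)})" by blast
  then show ?thesis by (simp add: prec_lenlex)
qed

lemma prec_irrefl [simp]: "\<not> z \<sqsubset> z"
  by (simp add: prec_lenlex lenlex_irreflexive)

lemma prec_trans: "x \<sqsubset> y \<Longrightarrow> y \<sqsubset> z \<Longrightarrow> x \<sqsubset> z"
  unfolding prec_lenlex by (erule lenlex_trans) (auto intro: transI)

lemma prec_asym: "x \<sqsubset> y \<Longrightarrow> \<not> y \<sqsubset> x"
  using prec_trans prec_irrefl by blast

lemma prec_total: "x = y \<or> x \<sqsubset> y \<or> y \<sqsubset> x"
  using total_lenlex[of "{(False, True)}"] by (auto simp: prec_lenlex total_on_def)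

lemma prec_length_le: "x \<sqsubset> y \<Longrightarrow> length x \<le> length y"
  by (auto simp: prec_def)

lemma pred_Q_prec: "z \<noteq> [] \<Longrightarrow> pred_Q z \<sqsubset> z"
  by (simp add: prec_def length_pred_Q)

lemma finite_prec: "finite {y. y \<sqsubset> z}"
  by (rule finite_subset[OF _ finite_lists_length_le[of UNIV "length z"]]) (auto dest: prec_length_le)

section \<open>The index as a number of runs\<close>

lemma idx_step_less:
  assumes "z \<in> Q" "t \<in> Q" "length z < length t"
  shows "idx z t = idx z (pred_Q t) + of_bool (\<not> z \<sqsubset> pred_Q t)"
    and "idx t z = idx (pred_Q t) z + of_bool (\<not> z \<sqsubset> pred_Q t)"
proof -
  have t: "t \<noteq> []" using assms by auto
  then have t: "t \<noteq> []" "pred_Q t \<in> Q" using assms by auto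
  have lt: "length (pred_Q t) < length t" using t by (simp add: length_pred_Q)
  have zp: "length (pred_Q z) \<le> length z" by (simp add: pred_Q_def)
  note p = perp_less_iff[OF _ assms(1) t(2)]
  have q: "z \<sqsubset> pred_Q t \<longleftrightarrow> length z < length (pred_Q t) \<or> length z = length (pred_Q t) \<and> (z, pred_Q t) \<in> perp_less"
    using p by (auto simp: prec_def)
  show "idx z t = idx z (pred_Q t) + of_bool (\<not> z \<sqsubset> pred_Q t)"
    using assms(3) t lt zp q
    by (subst idx.simps) (auto simp: nat_neq_iff)
  show "idx t z = idx (pred_Q t) z + of_bool (\<not> z \<sqsubset> pred_Q t)"
    using assms(3) t lt zp q
    by (subst idx.simps) (auto simp: nat_neq_iff)
qed

text \<open>
  The sequences \<open>z\<close> and \<open>t\<close> both end in a one at the same place, so their first difference is earlier, and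
  the one that \<open>t\<close> has there belongs to \<open>pred_Q t\<close>. So the lexicographic order of the predecessors, which
  appears in the clauses of the index for equal lengths, is that of \<open>z\<close> and \<open>t\<close>.
\<close>
lemma lex_less_pred_Q:
  assumes "z \<in> Q" "t \<in> Q" "length z = length t" "z \<sqsubset> t"
  defines "a \<equiv> pred_Q z" and "b \<equiv> pred_Q t"
  shows "lex_less a b"
proof -
  have "lex_less z t" using assms by (simp add: prec_def)
  then obtain i where i: "i < length z" "i < length t" "\<forall>k<i. z ! k = t ! k" "\<not> z ! i" "t ! i"
    using assms(3) by (auto simp: lex_less_iff)
  have ne: "z \<noteq> []" "t \<noteq> []" using i by auto
  have "z ! (length z - 1)" using assms(1) ne by (simp add: Q_iff last_conv_nth)
  then have i': "i < length z - 1" using i assms(3) by (metis One_nat_def Suc_pred length_greater_0_conv less_SucE ne(1))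
  then have ib: "i < length b" using nth_Q_after_pred_Q[OF assms(2), of i] i assms(3) b_def by (metis not_le nat_neq_iff)
  have ab: "\<And>k. k < length a \<Longrightarrow> a ! k = z ! k" "\<And>k. k < length b \<Longrightarrow> b ! k = t ! k"
    by (auto simp: a_def b_def nth_pred_Q)
  show "lex_less a b"
  proof (cases "i < length a")
    case True
    then show ?thesis unfolding lex_less_iff using i ib ab by (intro disjI2 exI[of _ i]) auto
  next
    case False
    then show ?thesis unfolding lex_less_iff using i ib ab by (intro disjI1) auto
  qed
qed

lemma lex_less_asym: "lex_less z t \<Longrightarrow> \<not> lex_less t z"
proof -
  have "asym {(a :: bool, b). a < b}" by (auto simp: asym_on_def)
  then show "lex_less z t \<Longrightarrow> \<not> lex_less t z" unfolding lex_less_def by (rule lexord_asymmetric)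
qed

lemma idx_same_length:
  assumes "z \<in> Q" "t \<in> Q" "length z = length t" "z \<sqsubset> t"
  shows "idx z t = idx (pred_Q z) (pred_Q t) + 1 + of_bool (\<not> pred_Q t \<sqsubset> pred_Q z)"
    and "idx t z = idx (pred_Q t) (pred_Q z) + 1 + of_bool (\<not> pred_Q t \<sqsubset> pred_Q z)"
proof -
  let ?a = "pred_Q z" and ?b = "pred_Q t"
  have ab: "lex_less ?a ?b" "\<not> lex_less ?b ?a"
    using lex_less_pred_Q[OF assms] lex_less_asym by auto
  have ne: "z \<noteq> t" "z \<noteq> []" "t \<noteq> []" "?a \<noteq> ?b"
  proof -
    show ab': "?a \<noteq> ?b" using ab by auto
    show "z \<noteq> t" using ab' by auto
    then show "z \<noteq> []" "t \<noteq> []" using assms(3) by auto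
  qed
  have len: "length ?a < length t" "length ?b < length t"
    using length_pred_Q[OF ne(2)] length_pred_Q[OF ne(3)] assms(3) by auto
  have len': "\<not> length t < length ?a" "\<not> length t < length ?b" "length t \<noteq> length ?a" "length t \<noteq> length ?b"
    using len by auto
  have cost: "?b \<sqsubset> ?a \<longleftrightarrow> length ?b < length ?a" using ab by (auto simp: prec_def)
  note facts = ne ne(1,4)[symmetric] len len' ab assms(3)
  show "idx z t = idx ?a ?b + 1 + of_bool (\<not> ?b \<sqsubset> ?a)"
    unfolding cost
    by (subst idx.simps, rule linorder_cases[of "length ?a" "length ?b"]) (simp_all add: facts)
  show "idx t z = idx ?b ?a + 1 + of_bool (\<not> ?b \<sqsubset> ?a)"
    unfolding cost
    by (subst idx.simps, rule linorder_cases[of "length ?a" "length ?b"]) (simp_all add: facts)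
qed

text \<open>
  Removing the last ancestor of the larger sequence costs one unit exactly if the other sequence is
  then not the smaller one, that is, if a run has been exhausted. For sequences of different lengths
  this is a clause of the definition; for equal lengths the definition removes both last ancestors
  in one step, which amounts to two such removals.
\<close>
lemma idx_prec_both:
  assumes "z \<in> Q" "t \<in> Q" "z \<sqsubset> t"
  shows "idx z t = idx z (pred_Q t) + of_bool (\<not> z \<sqsubset> pred_Q t) \<and>
         idx t z = idx (pred_Q t) z + of_bool (\<not> z \<sqsubset> pred_Q t)"
proof (cases "length z = length t")
  case False
  then have "length z < length t" using assms(3) by (auto simp: prec_def)
  then show ?thesis using idx_step_less[OF assms(1,2)] by simp
next
  case True
  have ne: "z \<noteq> []" "t \<noteq> []" using assms True by (auto simp: prec_def lex_less_iff)
  then have l: "length (pred_Q t) < length z" using True by (metis length_pred_Q)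
  then have "\<not> z \<sqsubset> pred_Q t" by (auto simp: prec_def)
  then show ?thesis
    using idx_same_length[OF assms(1,2) True assms(3)] idx_step_less[OF pred_Q_in_Q[OF assms(2) ne(2)] assms(1) l]
    by simp
qed

lemma idx_prec: "z \<in> Q \<Longrightarrow> t \<in> Q \<Longrightarrow> z \<sqsubset> t \<Longrightarrow> idx z t = idx z (pred_Q t) + of_bool (\<not> z \<sqsubset> pred_Q t)"
  using idx_prec_both by blast

lemma idx_self [simp]: "idx z z = 0"
  by (subst idx.simps) simp

lemma idx_commute:
  assumes "z \<in> Q" "t \<in> Q"
  shows "idx z t = idx t z"
  using assms
proof (induction "length z + length t" arbitrary: z t rule: less_induct)
  case less
  have *: "idx x y = idx y x" if "x \<in> Q" "y \<in> Q" "x \<sqsubset> y" "length z + length t = length x + length y" for x y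
  proof -
    have "y \<noteq> []" using that by (auto simp: prec_def lex_less_iff)
    then show ?thesis
      using less.hyps[of x "pred_Q y"] that idx_prec_both[OF that(1-3)] by (simp add: length_pred_Q)
  qed
  then show ?case using prec_total[of z t] less.prems by (metis add.commute)
qed

text \<open>
  Pairs of chains with ones at alternate places: their merged chain of ancestors has only runs of
  length one.
\<close>
primrec zigzag :: "nat \<Rightarrow> bool list \<times> bool list" where
  "zigzag 0 = ([], [True])"
| "zigzag (Suc n) = (snd (zigzag n), fst (zigzag n) @ [False, True])"

lemma idx_surj:
  assumes "0 < p"
  obtains z t where "z \<in> Q" "t \<in> Q" "z \<noteq> t" "idx z t = p"
proof -
  have "fst (zigzag n) \<in> Q \<and> snd (zigzag n) \<in> Q \<and> length (fst (zigzag n)) = n \<and>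
        length (snd (zigzag n)) = Suc n \<and> idx (fst (zigzag n)) (snd (zigzag n)) = Suc n" for n
  proof (induction n)
    case 0
    have "pred_Q [True] = []" using pred_Q_append_zeros_one[of "[]" 0] by (simp add: Q_iff)
    then have "idx [] [True] = 1" using idx_prec[of "[]" "[True]"] by (simp add: Q_iff prec_def)
    then show ?case by (simp add: Q_iff)
  next
    case (Suc n)
    let ?z = "fst (zigzag n)" and ?t = "snd (zigzag n)"
    let ?u = "?z @ [False, True]"
    have u: "?u \<in> Q" "pred_Q ?u = ?z" using pred_Q_append_zeros_one[of ?z 1] Suc by (auto simp: Q_iff)
    have "idx ?t ?u = idx ?t ?z + 1"
      using idx_prec[of ?t ?u] u Suc by (simp add: prec_def)
    then show ?case using Suc u idx_commute[of ?t ?z] by simp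
  qed
  from this[of "p - 1"] that assms show thesis by (metis Suc_pred' n_not_Suc_n)
qed

section \<open>Maps of the tree that preserve the index\<close>

lemma zeros_ext_eq_iff: "z \<in> Q \<Longrightarrow> t \<in> Q \<Longrightarrow> zeros_ext z = zeros_ext t \<longleftrightarrow> z = t"
proof
  assume zt: "z \<in> Q" "t \<in> Q" and eq: "zeros_ext z = zeros_ext t"
  have le: "length u \<le> length v" if "u \<in> Q" "zeros_ext u = zeros_ext v" for u v
  proof (cases "u = []")
    case False
    then have "zeros_ext u (length u - 1)" using that(1) by (simp add: zeros_ext_def Q_iff last_conv_nth)
    then have "zeros_ext v (length u - 1)" using that(2) by simp
    then have "length u - 1 < length v" by (simp add: zeros_ext_def)
    then show ?thesis by linarith
  qed simp
  have "length z = length t" using le zt eq by (metis le_antisym)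
  then show "z = t" using eq by (auto simp: zeros_ext_def fun_eq_iff list_eq_iff_nth_eq)
qed simp

text \<open>
  The image of the parent, continued by zeros, is left unchanged up to a bound \<open>N\<close> that no earlier code exceeds, so all ancestors
  of \<open>\<theta> z\<close> that are not ancestors of \<open>\<theta> (pred_Q z)\<close> have lengths beyond \<open>N\<close>: they form a block lying after all
  the earlier blocks.
\<close>
locale spreading =
  fixes \<theta> :: "bool list \<Rightarrow> bool list"
  assumes in_Q: "z \<in> Q \<Longrightarrow> \<theta> z \<in> Q"
    and gap: "z \<in> Q \<Longrightarrow> z \<noteq> [] \<Longrightarrow>
      \<exists>N. (\<forall>y\<in>Q. y \<sqsubset> z \<longrightarrow> length (\<theta> y) \<le> N) \<and> N < length (\<theta> z) \<and>
          (\<forall>n<N. zeros_ext (\<theta> z) n = zeros_ext (\<theta> (pred_Q z)) n)"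
begin

lemma length_mono: "x \<in> Q \<Longrightarrow> y \<in> Q \<Longrightarrow> x \<sqsubset> y \<Longrightarrow> length (\<theta> x) < length (\<theta> y)"
  using gap[of y] by (fastforce simp: prec_def lex_less_iff)

lemma prec_iff: "x \<in> Q \<Longrightarrow> y \<in> Q \<Longrightarrow> \<theta> x \<sqsubset> \<theta> y \<longleftrightarrow> x \<sqsubset> y"
  using length_mono prec_total[of x y] by (metis prec_def prec_irrefl prec_asym)

text \<open>
  Descend from \<open>\<theta> t\<close> to \<open>\<theta> (pred_Q t)\<close> one ancestor at a time. The intermediate ancestors are all longer
  than \<open>\<theta> z\<close>, so only the last removal can end a run.
\<close>
lemma idx_prec_spread:
  assumes "z \<in> Q" "t \<in> Q" "z \<sqsubset> t"
  shows "idx (\<theta> z) (\<theta> t) = idx (\<theta> z) (\<theta> (pred_Q t)) + of_bool (\<not> z \<sqsubset> pred_Q t)"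
proof -
  have "t \<noteq> []" using assms(3) by (auto simp: prec_def lex_less_iff)
  then have t: "t \<noteq> []" "pred_Q t \<in> Q" using assms(2) by auto
  obtain N where N: "\<And>y. y \<in> Q \<Longrightarrow> y \<sqsubset> t \<Longrightarrow> length (\<theta> y) \<le> N" "N < length (\<theta> t)"
     "\<And>n. n < N \<Longrightarrow> zeros_ext (\<theta> t) n = zeros_ext (\<theta> (pred_Q t)) n"
    using gap[OF assms(2) t(1)] by blast
  let ?p = "\<theta> (pred_Q t)"
  have pN: "length ?p \<le> N" and zN: "length (\<theta> z) \<le> N" using N(1) assms t pred_Q_prec by auto
  have "y \<in> Q \<Longrightarrow> take (length y) (\<theta> t) = y \<Longrightarrow> length ?p < length y \<Longrightarrow>
      idx (\<theta> z) y = idx (\<theta> z) ?p + of_bool (\<not> z \<sqsubset> pred_Q t)" for y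
  proof (induction "length y" arbitrary: y rule: less_induct)
    case less
    have ny: "y \<noteq> []" using less.prems by auto
    have leny: "length y \<le> length (\<theta> t)" using less.prems(2) by (metis length_take min.cobounded1)
    have nthy: "y ! n = \<theta> t ! n" if "n < length y" for n using less.prems(2) that by (metis nth_take)
    \<comment> \<open>An ancestor ends in a one, and \<open>\<theta> t\<close> has no ones between the end of \<open>\<theta> (pred_Q t)\<close> and \<open>N\<close>.\<close>
    have longer: "N < length v" if v: "v \<in> Q" "take (length v) (\<theta> t) = v" "length ?p < length v" for v
    proof (rule ccontr)
      assume "\<not> N < length v"
      then have l: "length v - 1 < N" "length v - 1 < length (\<theta> t)" using v(3) N(2) by auto
      have "v \<noteq> []" using v by auto
      then have "v ! (length v - 1)" using v(1) by (simp add: Q_iff last_conv_nth)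
      then have "\<theta> t ! (length v - 1)" using v(2) \<open>v \<noteq> []\<close> by (metis diff_less length_greater_0_conv nth_take zero_less_one)
      then have "zeros_ext (\<theta> t) (length v - 1)" using l by (simp add: zeros_ext_def)
      then have "zeros_ext ?p (length v - 1)" using N(3) l by simp
      then have "length v - 1 < length ?p" by (simp add: zeros_ext_def)
      then show False using v(3) by linarith
    qed
    have "\<theta> z \<sqsubset> y" using longer[OF less.prems] zN by (auto simp: prec_def)
    then have step: "idx (\<theta> z) y = idx (\<theta> z) (pred_Q y) + of_bool (\<not> \<theta> z \<sqsubset> pred_Q y)"
      using idx_prec in_Q assms less.prems by simp
    have py: "pred_Q y \<in> Q" "length (pred_Q y) < length y" using less.prems ny by (auto simp: length_pred_Q)
    have tpy: "take (length (pred_Q y)) (\<theta> t) = pred_Q y"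
      using py(2) leny nthy by (auto simp: list_eq_iff_nth_eq nth_pred_Q)
    show ?case
    proof (cases "length ?p < length (pred_Q y)")
      case True
      then have "\<theta> z \<sqsubset> pred_Q y" using longer[OF py(1) tpy] zN by (auto simp: prec_def)
      then show ?thesis using less.hyps[OF py(2,1) tpy True] step by simp
    next
      case False
      \<comment> \<open>The ancestor \<open>y\<close> is the first one beyond \<open>N\<close>, so its predecessor is exactly \<open>\<theta> (pred_Q t)\<close>.\<close>
      have "pred_Q y = ?p"
      proof -
        have "zeros_ext (pred_Q y) n = zeros_ext ?p n" for n
        proof (cases "n < length ?p")
          case True
          have "n < N" using True pN by simp
          have ny': "n < length y" using True less.prems(3) by simp
          have "zeros_ext ?p n = \<theta> t ! n" using N(3)[OF \<open>n < N\<close>] N(2) \<open>n < N\<close> by (simp add: zeros_ext_def)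
          also have "\<dots> = y ! n" using nthy[OF ny'] by simp
          also have "\<dots> = zeros_ext (pred_Q y) n"
          proof (cases "n < length (pred_Q y)")
            case False
            then have "y ! n \<longleftrightarrow> n = length y - 1" using nth_Q_after_pred_Q[OF less.prems(1), of n] ny' by simp
            moreover have "n \<noteq> length y - 1" using longer[OF less.prems] \<open>n < N\<close> by linarith
            ultimately show ?thesis using False by (simp add: zeros_ext_def)
          qed (simp add: zeros_ext_def nth_pred_Q)
          finally show ?thesis by simp
        next
          case 2: False
          then show ?thesis using False by (simp add: zeros_ext_def)
        qed
        then show ?thesis using zeros_ext_eq_iff py(1) in_Q t(2) by blast
      qed
      then show ?thesis using step prec_iff[OF assms(1) t(2)] by simp
    qed
  qed
  from this[of "\<theta> t"] show ?thesis using in_Q assms N(2) pN by simp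
qed

theorem idx_spread:
  assumes "z \<in> Q" "t \<in> Q"
  shows "idx (\<theta> z) (\<theta> t) = idx z t"
  using assms
proof (induction "length z + length t" arbitrary: z t rule: less_induct)
  case less
  have *: "idx (\<theta> x) (\<theta> y) = idx x y"
    if "x \<in> Q" "y \<in> Q" "x \<sqsubset> y" "length z + length t = length x + length y" for x y
  proof -
    have "y \<noteq> []" using that by (auto simp: prec_def lex_less_iff)
    then show ?thesis
      using less.hyps[of x "pred_Q y"] that idx_prec[OF that(1-3)] idx_prec_spread[OF that(1-3)]
      by (simp add: length_pred_Q)
  qed
  show ?case using prec_total[of z t] less.prems * idx_commute in_Q by (metis add.commute idx_self)
qed

end

section \<open>Eventually zero sequences and their codes\<close>

definition supp_len :: "cantor \<Rightarrow> nat" where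
  "supp_len x = (LEAST N. \<forall>n\<ge>N. \<not> x n)"

text \<open>
  The inverse of \<^const>\<open>zeros_ext\<close> on \<open>Q\<close>; it is only meaningful on sequences with finitely many ones.
\<close>
definition trunc :: "cantor \<Rightarrow> bool list" where
  "trunc x = map x [0..<supp_len x]"

lemma notin_P_infinity_iff: "x \<notin> P_infinity \<longleftrightarrow> (\<exists>N. \<forall>n\<ge>N. \<not> x n)"
  unfolding P_infinity_def mem_Collect_eq infinite_nat_iff_unbounded_le by auto

lemma supp_len_bound: "x \<notin> P_infinity \<Longrightarrow> supp_len x \<le> n \<Longrightarrow> \<not> x n"
proof -
  assume "x \<notin> P_infinity" and n: "supp_len x \<le> n"
  then have "\<exists>N. \<forall>n\<ge>N. \<not> x n" by (simp add: notin_P_infinity_iff)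
  then have "\<forall>n\<ge>supp_len x. \<not> x n" unfolding supp_len_def by (rule LeastI_ex)
  then show "\<not> x n" using n by blast
qed

lemma supp_len_gt: "x \<notin> P_infinity \<Longrightarrow> x n \<Longrightarrow> n < supp_len x"
  using supp_len_bound not_le by blast

lemma length_trunc [simp]: "length (trunc x) = supp_len x"
  by (simp add: trunc_def)

lemma zeros_ext_trunc: "x \<notin> P_infinity \<Longrightarrow> zeros_ext (trunc x) = x"
  using supp_len_gt by (auto simp: zeros_ext_def trunc_def fun_eq_iff)

lemma trunc_in_Q: "x \<notin> P_infinity \<Longrightarrow> trunc x \<in> Q"
proof -
  assume x: "x \<notin> P_infinity"
  show "trunc x \<in> Q"
  proof (cases "supp_len x")
    case (Suc N)
    have "x N"
    proof (rule ccontr)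
      assume "\<not> x N"
      then have "\<forall>n\<ge>N. \<not> x n" using supp_len_bound[OF x] Suc by (metis le_antisym not_less_eq_eq)
      then have "supp_len x \<le> N" unfolding supp_len_def by (rule Least_le)
      then show False using Suc by simp
    qed
    then show ?thesis using Suc by (simp add: Q_iff trunc_def)
  qed (simp add: Q_iff trunc_def)
qed

lemma zeros_ext_notin_P_infinity [simp]: "zeros_ext z \<notin> P_infinity"
  unfolding notin_P_infinity_iff zeros_ext_def by (meson leD)

lemma trunc_zeros_ext: "z \<in> Q \<Longrightarrow> trunc (zeros_ext z) = z"
  using zeros_ext_eq_iff trunc_in_Q zeros_ext_trunc zeros_ext_notin_P_infinity by metis

definition init :: "bool list \<Rightarrow> cantor \<Rightarrow> bool" where
  "init v \<alpha> \<longleftrightarrow> (\<forall>i<length v. v ! i = \<alpha> i)"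

lemma init_zeros_ext: "init z (zeros_ext z)"
  by (simp add: init_def zeros_ext_def)

lemma init_trunc: "init (trunc \<alpha>) \<alpha>"
  by (simp add: init_def trunc_def)

lemma init_pred_Q:
  assumes "init z \<alpha>" shows "init (pred_Q z) \<alpha>"
proof -
  have "length (pred_Q z) \<le> length z" by (simp add: pred_Q_def)
  then show ?thesis using assms by (auto simp: init_def nth_pred_Q)
qed

lemma init_last: "z \<in> Q \<Longrightarrow> z \<noteq> [] \<Longrightarrow> init z \<alpha> \<Longrightarrow> \<alpha> (length z - 1)"
  by (auto simp: init_def Q_iff last_conv_nth)

lemma init_length_le_pred_Q:
  assumes "v \<in> Q" "z \<in> Q" "init v \<alpha>" "init z \<alpha>" "length v < length z"
  shows "length v \<le> length (pred_Q z)"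
proof (rule ccontr)
  assume *: "\<not> length v \<le> length (pred_Q z)"
  then have v: "v \<noteq> []" by auto
  then have "\<alpha> (length v - 1)" using init_last assms by blast
  then have "z ! (length v - 1)" using assms(4,5) by (simp add: init_def)
  moreover have "0 < length v" using v by simp
  ultimately show False
    using nth_Q_after_pred_Q[OF assms(2), of "length v - 1"] * assms(5) by linarith
qed

text \<open>
  The cone above \<open>p\<close> consists of \<open>p 0\<^sup>\<omega>\<close> and the cones above the children of \<open>p\<close>.
\<close>
lemma next_one:
  assumes "p \<in> Q" "init p \<alpha>" "n \<ge> length p" "\<alpha> n"
  obtains y where "y \<in> Q" "y \<noteq> []" "pred_Q y = p" "init y \<alpha>" "length y \<le> Suc n"
proof -
  define i where "i = (LEAST i. i \<ge> length p \<and> \<alpha> i)"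
  have i: "i \<ge> length p" "\<alpha> i" "i \<le> n"
    using LeastI[of "\<lambda>i. i \<ge> length p \<and> \<alpha> i" n] Least_le[of "\<lambda>i. i \<ge> length p \<and> \<alpha> i" n] assms
    by (auto simp: i_def)
  have before: "\<not> \<alpha> k" if "length p \<le> k" "k < i" for k
    using not_less_Least[of k "\<lambda>i. i \<ge> length p \<and> \<alpha> i"] that by (auto simp: i_def)
  define y where "y = p @ replicate (i - length p) False @ [True]"
  have "init y \<alpha>"
    unfolding init_def
  proof (intro allI impI)
    fix k assume "k < length y"
    then consider "k < length p" | "length p \<le> k" "k < i" | "k = i" using i by (auto simp: y_def) linarith
    then show "y ! k = \<alpha> k"
      using assms(2) i before by cases (auto simp: y_def init_def nth_append)
  qed
  moreover have "y \<in> Q" "y \<noteq> []" "pred_Q y = p" "length y = Suc i"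
    using pred_Q_append_zeros_one[OF assms(1)] i by (auto simp: y_def Q_iff)
  ultimately show thesis using that i by simp
qed

section \<open>Cylinders and the Cantor space\<close>

lemma open_cylinder: "open {y :: nat \<Rightarrow> 'a::discrete_topology. \<forall>i<n. y i = x i}"
proof -
  have "open {y. y i \<in> {x i}}" for i :: nat
  proof -
    have "open ((\<lambda>y :: nat \<Rightarrow> 'a. y i) -` {x i})"
      by (rule open_vimage) (auto simp: open_discrete)
    then show ?thesis by (simp add: vimage_def)
  qed
  then have "open (\<Inter>i\<in>{..<n}. {y. y i \<in> {x i}})" by (intro open_INT) auto
  moreover have "(\<Inter>i\<in>{..<n}. {y. y i \<in> {x i}}) = {y. \<forall>i<n. y i = x i}" by auto
  ultimately show ?thesis by simp
qed

lemma open_contains_cylinder: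
  fixes x :: "nat \<Rightarrow> 'a::discrete_topology"
  assumes "open U" "x \<in> U"
  obtains n where "\<And>y. (\<And>i. i < n \<Longrightarrow> y i = x i) \<Longrightarrow> y \<in> U"
proof -
  have "openin (product_topology (\<lambda>i. euclidean) UNIV) U"
    using assms(1) by (simp add: euclidean_product_topology)
  from product_topology_open_contains_basis[OF this assms(2)]
  obtain V where V: "x \<in> Pi\<^sub>E UNIV V" "finite {i. V i \<noteq> UNIV}" "Pi\<^sub>E UNIV V \<subseteq> U"
    unfolding topspace_euclidean by (elim exE conjE) (rule that)
  obtain n where n: "\<forall>i\<in>{i. V i \<noteq> UNIV}. i < n" using finite_nat_set_iff_bounded[THEN iffD1, OF V(2)] ..
  show thesis
  proof (rule that)
    fix y assume "\<And>i. i < n \<Longrightarrow> y i = x i"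
    then have "y i \<in> V i" for i
      using PiE_mem[OF V(1), of i] n by (cases "V i = UNIV") auto
    then show "y \<in> U" using V(3) by blast
  qed
qed

definition cyl :: "nat list \<Rightarrow> (nat \<Rightarrow> nat) set" where
  "cyl s = {w. \<forall>i<length s. w i = s ! i}"

lemma cyl_Nil [simp]: "cyl [] = UNIV"
  by (simp add: cyl_def)

lemma countable_compl_P_infinity: "countable (- P_infinity)"
proof -
  have "- P_infinity \<subseteq> range zeros_ext" using zeros_ext_trunc by (metis ComplD rangeI subsetI)
  then show ?thesis by (rule countable_subset) simp
qed

lemma cylinder_meets:
  "\<exists>y \<in> P_infinity. \<forall>i<n. y i = x i"
  "\<exists>y. y \<notin> P_infinity \<and> (\<forall>i<n. y i = x i)"
proof -
  have "(\<lambda>i. i < n \<longrightarrow> x i) \<in> P_infinity"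
    by (rule ccontr) (metis less_irrefl max.cobounded1 max.cobounded2 notin_P_infinity_iff not_le)
  then show "\<exists>y \<in> P_infinity. \<forall>i<n. y i = x i" by (rule bexI[rotated]) simp
  have "zeros_ext (map x [0..<n]) i = x i" if "i < n" for i using that by (simp add: zeros_ext_def)
  then show "\<exists>y. y \<notin> P_infinity \<and> (\<forall>i<n. y i = x i)" by (metis zeros_ext_notin_P_infinity)
qed

lemma closed_Collect_eq_cantor:
  fixes f g :: "'x::topological_space \<Rightarrow> cantor"
  assumes "continuous_on UNIV f" "continuous_on UNIV g"
  shows "closed {x. f x = g x}"
proof -
  have "closed {x. f x n = g x n}" for n
    by (rule closed_Collect_eq[OF assms[THEN continuous_on_product_then_coordinatewise]])
  then have "closed {x. \<forall>n. f x n = g x n}" by (rule closed_Collect_all)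
  then show ?thesis by (simp add: fun_eq_iff)
qed

lemma closed_singleton_metrizable:
  "metrizable_space (euclidean :: 'x::topological_space topology) \<Longrightarrow> closed {x :: 'x}"
  using metrizable_imp_t1_space[of "euclidean :: 'x topology"] by (simp add: t1_space_closedin_singleton)

lemma completely_metrizable_cantor: "completely_metrizable_space (euclidean :: cantor topology)"
proof -
  have "(euclidean :: bool topology) = discrete_topology UNIV"
    by (simp add: topology_eq open_discrete)
  then have "completely_metrizable_space (euclidean :: bool topology)"
    by (simp add: completely_metrizable_space_discrete_topology)
  then have "completely_metrizable_space (product_topology (\<lambda>_. euclidean :: bool topology) (UNIV :: nat set))"
    unfolding completely_metrizable_space_product_topology by auto
  then show ?thesis by (simp add: euclidean_product_topology)
qed

lemma separable_cantor: "separable_space (euclidean :: cantor topology)"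
  unfolding separable_space_def
proof (intro exI conjI)
  show "euclidean closure_of (- P_infinity) = topspace euclidean"
  proof -
    have "x \<in> closure (- P_infinity)" for x
      unfolding closure_iff_nhds_not_empty
    proof (intro allI impI)
      fix A V :: "cantor set" assume V: "V \<subseteq> A" "open V" "x \<in> V"
      then obtain n where "\<And>y. (\<And>i. i < n \<Longrightarrow> y i = x i) \<Longrightarrow> y \<in> V" using open_contains_cylinder[OF V(2,3)] by metis
      then show "- P_infinity \<inter> A \<noteq> {}" using cylinder_meets(2)[of n x] V(1) by blast
    qed
    then show ?thesis by auto
  qed
qed (use countable_compl_P_infinity in auto)

text \<open>
  By Baire's theorem, since both \<^const>\<open>P_infinity\<close> and its countable complement are dense.
\<close>
lemma not_fsigma_P_infinity: "\<not> fsigma_in euclidean P_infinity"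
proof
  assume "fsigma_in euclidean P_infinity"
  then obtain C where "(\<forall>n. closedin euclidean (C n)) \<and> (\<forall>n. C n \<subseteq> C (Suc n)) \<and> \<Union>(range C) = P_infinity"
    unfolding fsigma_in_ascending ..
  then have C: "\<And>n. closed (C n)" "\<Union>(range C) = P_infinity" by simp_all
  let ?\<G> = "range C \<union> (\<lambda>x. {x}) ` (- P_infinity)"
  have "euclidean interior_of \<Union>?\<G> = {}"
  proof (rule Baire_category_alt)
    show "countable ?\<G>" using countable_compl_P_infinity by auto
    fix T assume T: "T \<in> ?\<G>"
    have nowhere: "V = {}" if V: "open V" "V \<subseteq> T" for V :: "cantor set"
    proof (rule ccontr)
      assume "V \<noteq> {}"
      then obtain x where x: "x \<in> V" by blast
      obtain n where n: "\<And>y. (\<And>i. i < n \<Longrightarrow> y i = x i) \<Longrightarrow> y \<in> V" using open_contains_cylinder[OF V(1) x] by metis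
      obtain y y' where "y \<in> P_infinity" "y \<in> V" "y' \<notin> P_infinity" "y' \<in> V"
        using cylinder_meets[of n x] n by metis
      then show False using T C(2) V(2) by blast
    qed
    have "closed T"
      using T C(1) closed_singleton_metrizable
        completely_metrizable_imp_metrizable_space[OF completely_metrizable_cantor] by auto
    moreover have "euclidean interior_of T = {}"
      using nowhere[OF open_interior interior_subset] by simp
    ultimately show "closedin euclidean T \<and> euclidean interior_of T = {}" by simp
  qed (use completely_metrizable_cantor in simp)
  moreover have "\<Union>?\<G> = UNIV" using C(2) by auto
  ultimately show False by simp
qed

lemma fsigma_in_countable:
  assumes "t1_space X" "countable S" "S \<subseteq> topspace X"
  shows "fsigma_in X S"
proof -
  have "fsigma_in X (\<Union>((\<lambda>x. {x}) ` S))"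
    using assms by (intro fsigma_in_Union closed_imp_fsigma_in)
      (auto intro!: closed_imp_fsigma_in simp: t1_space_closedin_singleton)
  then show ?thesis by simp
qed

lemma fsigma_in_continuous_preimage:
  assumes "continuous_map X Y f" "fsigma_in Y S"
  shows "fsigma_in X {x \<in> topspace X. f x \<in> S}"
proof -
  obtain C where "(\<forall>n. closedin Y (C n)) \<and> (\<forall>n. C n \<subseteq> C (Suc n)) \<and> \<Union>(range C) = S"
    using assms(2) unfolding fsigma_in_ascending ..
  then have C: "\<And>n. closedin Y (C n)" "\<Union>(range C) = S" by simp_all
  have "fsigma_in X (\<Union>n. {x \<in> topspace X. f x \<in> C n})"
    using closedin_continuous_map_preimage[OF assms(1) C(1)]
    by (intro fsigma_in_Union) (auto intro: closed_imp_fsigma_in)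
  also have "(\<Union>n. {x \<in> topspace X. f x \<in> C n}) = {x \<in> topspace X. f x \<in> S}" using C(2) by auto
  finally show ?thesis .
qed

section \<open>Index-preserving Cantor sets in non-F-sigma situations\<close>

text \<open>
  A continuous image of a closed subset of the Baire space, with finitely many maps to the Cantor
  space that all detect the same non-\<open>F\<^sub>\<sigma>\<close> set \<open>D\<close> as the preimage of \<^const>\<open>P_infinity\<close>.
\<close>
locale non_fsigma_map = Metric_space M d
  for M :: "'z set" and d +
  fixes W :: "(nat \<Rightarrow> nat) set" and g :: "(nat \<Rightarrow> nat) \<Rightarrow> 'z"
    and h :: "'j::finite \<Rightarrow> 'z \<Rightarrow> cantor" and D :: "'z set"
  assumes closed_W: "closed W"
    and cont_g: "continuous_map (top_of_set W) mtopology g"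
    and range_g: "g ` W = M"
    and cont_h: "\<And>j. continuous_map mtopology euclidean (h j)"
    and h_D: "\<And>j x. x \<in> M \<Longrightarrow> h j x \<in> P_infinity \<longleftrightarrow> x \<in> D"
    and D_subset: "D \<subseteq> M"
    and not_fsigma: "\<not> fsigma_in mtopology D"
begin

definition fsigma_separated :: "nat list \<Rightarrow> bool" where
  "fsigma_separated s \<longleftrightarrow> (\<exists>S. fsigma_in mtopology S \<and> g ` (W \<inter> cyl s) \<inter> D \<subseteq> S \<and> S \<subseteq> D)"

text \<open>
  The kernel of the problem: the part of \<open>W\<close> near which \<open>D\<close> is nowhere separated by an \<open>F\<^sub>\<sigma>\<close> set from its
  complement. It plays the role of the perfect kernel in the Cantor-Bendixson theorem.
\<close>
definition core :: "(nat \<Rightarrow> nat) set" where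
  "core = {w \<in> W. \<forall>s. w \<in> cyl s \<longrightarrow> \<not> fsigma_separated s}"

text \<open>
  The witness \<open>w\<close> is required to have its image in \<open>D\<close>, so that \<open>h\<^sub>j (g w)\<close> has infinitely many ones while
  \<open>h\<^sub>j c\<close> has finitely many: this forces the two apart for every \<open>j\<close>, although they are close.
\<close>
definition adherent :: "nat list \<Rightarrow> 'z \<Rightarrow> bool" where
  "adherent s c \<longleftrightarrow> c \<in> M - D \<and> (\<forall>\<epsilon>>0. \<exists>w \<in> core \<inter> cyl s. g w \<in> D \<and> d c (g w) < \<epsilon>)"

lemma core_subset: "core \<subseteq> W"
  by (auto simp: core_def)

text \<open>
  There are only countably many cylinders.
\<close>
lemma fsigma_outside_core:
  obtains S where "fsigma_in mtopology S" "g ` (W - core) \<inter> D \<subseteq> S" "S \<subseteq> D"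
proof -
  define T where "T s = (SOME S. fsigma_in mtopology S \<and> g ` (W \<inter> cyl s) \<inter> D \<subseteq> S \<and> S \<subseteq> D)" for s
  have T: "fsigma_in mtopology (T s) \<and> g ` (W \<inter> cyl s) \<inter> D \<subseteq> T s \<and> T s \<subseteq> D" if "fsigma_separated s" for s
    using that unfolding T_def fsigma_separated_def by (rule someI_ex)
  have "fsigma_in mtopology (\<Union>(T ` {s. fsigma_separated s}))"
    by (rule fsigma_in_Union) (use T in auto)
  moreover have "g ` (W - core) \<inter> D \<subseteq> \<Union>(T ` {s. fsigma_separated s})"
    using T by (fastforce simp: core_def)
  ultimately show thesis using that T by blast
qed

lemma core_nonempty: "core \<noteq> {}"
proof
  assume "core = {}"
  then obtain S where S: "fsigma_in mtopology S" "g ` W \<inter> D \<subseteq> S" "S \<subseteq> D"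
    using fsigma_outside_core by (metis Diff_empty)
  then have "S = D" using range_g D_subset by auto
  then show False using S not_fsigma by simp
qed

text \<open>
  Otherwise the closure of the image of the core in the cylinder would stay inside \<open>D\<close> and, together
  with an \<open>F\<^sub>\<sigma>\<close> set taking care of what is outside the core, would separate the part of \<open>D\<close> that comes from the cylinder.
\<close>
lemma ex_adherent:
  assumes "core \<inter> cyl s \<noteq> {}"
  shows "\<exists>c. adherent s c"
proof (rule ccontr)
  assume no: "\<not> ?thesis"
  let ?A = "g ` (core \<inter> cyl s) \<inter> D"
  let ?S1 = "mtopology closure_of ?A"
  obtain S where S: "fsigma_in mtopology S" "g ` (W - core) \<inter> D \<subseteq> S" "S \<subseteq> D"
    using fsigma_outside_core .
  have "?S1 \<subseteq> D"
  proof
    fix c assume c: "c \<in> ?S1"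
    then have cM: "c \<in> M" and near: "\<And>r. r > 0 \<Longrightarrow> \<exists>y \<in> ?A. y \<in> mball c r"
      by (auto simp: metric_closure_of)
    have "\<exists>w \<in> core \<inter> cyl s. g w \<in> D \<and> d c (g w) < \<epsilon>" if "\<epsilon> > 0" for \<epsilon>
      using near[OF that] by (auto simp: in_mball)
    then show "c \<in> D" using no cM unfolding adherent_def by blast
  qed
  moreover have "?A \<subseteq> ?S1" by (rule closure_of_subset) (use D_subset in auto)
  moreover have "g ` (W \<inter> cyl s) \<inter> D \<subseteq> ?A \<union> g ` (W - core) \<inter> D" by blast
  moreover have "fsigma_in mtopology (?S1 \<union> S)"
    by (intro fsigma_in_Un closed_imp_fsigma_in closedin_closure_of S(1))
  ultimately have "fsigma_separated s"
    unfolding fsigma_separated_def using S(2,3) by (intro exI[of _ "?S1 \<union> S"]) blast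
  then show False using assms by (auto simp: core_def)
qed

lemma openin_h_agree:
  assumes "\<And>j. finite (A j)"
  shows "openin mtopology {x \<in> M. \<forall>j. \<forall>n\<in>A j. h j x n = h j c n}"
proof -
  have *: "openin mtopology {x \<in> M. h j x n = h j c n}" for j n
  proof -
    have "open ((\<lambda>y :: cantor. y n) -` {h j c n})" by (rule open_vimage) (auto simp: open_discrete)
    then have "openin euclidean {y :: cantor. y n = h j c n}" by (simp add: vimage_def)
    then show ?thesis using openin_continuous_map_preimage[OF cont_h] by fastforce
  qed
  have "openin mtopology (topspace mtopology \<inter> (\<Inter>q\<in>Sigma UNIV A. {x \<in> M. h (fst q) x (snd q) = h (fst q) c (snd q)}))"
    by (subst Int_commute, rule openin_INT) (use assms * in \<open>auto intro: finite_SigmaI\<close>)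
  moreover have "topspace mtopology \<inter> (\<Inter>q\<in>Sigma UNIV A. {x \<in> M. h (fst q) x (snd q) = h (fst q) c (snd q)}) =
       {x \<in> M. \<forall>j. \<forall>n\<in>A j. h j x n = h j c n}" by auto
  ultimately show ?thesis by simp
qed

text \<open>
  One step of the construction: \<open>f\<close> gives the cylinders and the points chosen so far, and \<open>s\<close> is the
  cylinder for \<open>z\<close>. On it, all \<open>h\<^sub>j\<close> agree with the value at the parent's point up to \<open>N\<close>, a bound on all
  the lengths of the codes chosen before, and \<open>m j\<close> is the place of a later one. These conditions are
  imposed on the whole cylinder since they pass to limits, hence both to the point chosen for \<open>z\<close> and to
  all points of the Cantor set above \<open>z\<close>.
\<close>
definition narrow :: "(bool list \<Rightarrow> nat list \<times> 'z) \<Rightarrow> bool list \<Rightarrow> nat list \<Rightarrow> nat \<Rightarrow> ('j \<Rightarrow> nat) \<Rightarrow> bool" where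
  "narrow f z s N m \<longleftrightarrow>
     cyl s \<subseteq> cyl (fst (f (pred_Q z))) \<and> length z \<le> length s \<and> length z \<le> N \<and>
     (\<forall>y j. y \<sqsubset> z \<longrightarrow> supp_len (h j (snd (f y))) \<le> N) \<and> (\<forall>j. N \<le> m j) \<and>
     (\<forall>w \<in> W \<inter> cyl s. d (snd (f (pred_Q z))) (g w) \<le> (1/2) ^ length z \<and>
        (\<forall>j. (\<forall>n<N. h j (g w) n = h j (snd (f (pred_Q z))) n) \<and> h j (g w) (m j)))"

definition stage :: "(bool list \<Rightarrow> nat list \<times> 'z) \<Rightarrow> bool list \<Rightarrow> nat list \<times> 'z \<Rightarrow> bool" where
  "stage f z r \<longleftrightarrow> core \<inter> cyl (fst r) \<noteq> {} \<and> adherent (fst r) (snd r) \<and>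
     (z \<in> Q \<and> z \<noteq> [] \<longrightarrow> (\<exists>N m. narrow f z (fst r) N m))"

text \<open>
  Choose \<open>g w \<in> D\<close> near the parent's point \<open>cp\<close>, so near that all \<open>h\<^sub>j\<close> agree with their values at \<open>cp\<close> up
  to \<open>N\<close>. As \<open>h\<^sub>j (g w)\<close> has infinitely many ones, it has one beyond \<open>N\<close>. All this persists on a small
  cylinder around \<open>w\<close>.
\<close>
lemma ex_stage:
  assumes prev: "\<And>y. y \<sqsubset> z \<Longrightarrow> stage f y (f y)"
  shows "\<exists>r. stage f z r"
proof (cases "z \<in> Q \<and> z \<noteq> []")
  case False
  obtain c where "adherent [] c" using ex_adherent[of "[]"] core_nonempty by auto
  then have "stage f z ([], c)" using False core_nonempty by (auto simp: stage_def)
  then show ?thesis by blast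
next
  case True
  then have "stage f (pred_Q z) (f (pred_Q z))" using prev pred_Q_prec by blast
  then obtain sp cp where fp: "f (pred_Q z) = (sp, cp)" and adp: "adherent sp cp"
    by (cases "f (pred_Q z)") (auto simp: stage_def)
  then have cpM: "cp \<in> M" by (simp add: adherent_def)
  define B where "B = (\<lambda>(y, j). supp_len (h j (snd (f y)))) ` ({y. y \<sqsubset> z} \<times> UNIV)"
  have "finite B" unfolding B_def using finite_prec by (intro finite_imageI finite_cartesian_product) auto
  define N where "N = Max (insert (length z) B)"
  have N: "length z \<le> N" "\<And>b. b \<in> B \<Longrightarrow> b \<le> N" using \<open>finite B\<close> by (auto simp: N_def)
  define O1 where "O1 = {x \<in> M. \<forall>j. \<forall>n\<in>{..<N}. h j x n = h j cp n} \<inter> mball cp ((1/2) ^ length z)"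
  have O1: "openin mtopology O1" "cp \<in> O1"
    using openin_h_agree[of "\<lambda>_. {..<N}" cp] cpM by (auto simp: O1_def)
  then obtain r where r: "r > 0" "mball cp r \<subseteq> O1" unfolding openin_mtopology by blast
  then obtain w where w: "w \<in> core" "w \<in> cyl sp" "g w \<in> D" "d cp (g w) < r"
    using adp unfolding adherent_def by blast
  have wW: "w \<in> W" using w core_subset by auto
  have gM: "g w \<in> M" using w(3) D_subset by blast
  moreover have "g w \<in> mball cp r" using w(4) gM cpM by (simp add: in_mball)
  ultimately have gw: "g w \<in> M" "g w \<in> O1" using r(2) by auto
  have "\<exists>m\<ge>N. h j (g w) m" for j
    using h_D[OF gw(1), of j] w(3) notin_P_infinity_iff by blast
  then obtain m where m: "\<And>j. N \<le> m j" "\<And>j. h j (g w) (m j)" by metis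
  define O2 where "O2 = O1 \<inter> {x \<in> M. \<forall>j. \<forall>n\<in>{m j}. h j x n = h j (g w) n}"
  have O2: "openin mtopology O2" "g w \<in> O2"
    using openin_h_agree[of "\<lambda>j. {m j}" "g w"] O1 gw by (auto simp: O2_def)
  then have "openin (top_of_set W) {x \<in> W. g x \<in> O2}"
    using openin_continuous_map_preimage[OF cont_g O2(1)] by simp
  then obtain U where U: "open U" "{x \<in> W. g x \<in> O2} = W \<inter> U" by (auto simp: openin_open)
  then have "w \<in> U" using wW O2 by auto
  then obtain n where n: "\<And>y. (\<And>i. i < n \<Longrightarrow> y i = w i) \<Longrightarrow> y \<in> U"
    using open_contains_cylinder[OF U(1)] by metis
  define l where "l = max n (max (length sp) (length z))"
  define s where "s = map w [0..<l]"
  have ws: "w \<in> cyl s" by (simp add: cyl_def s_def)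
  then have ne: "core \<inter> cyl s \<noteq> {}" using w by blast
  then obtain c where c: "adherent s c" using ex_adherent by blast
  have in_O2: "g v \<in> O2" if "v \<in> W \<inter> cyl s" for v
  proof -
    have "v i = w i" if "i < n" for i using \<open>v \<in> W \<inter> cyl s\<close> that by (simp add: cyl_def s_def l_def)
    then show ?thesis using n U(2) that by blast
  qed
  have sub: "cyl s \<subseteq> cyl sp" using w(2) by (auto simp: cyl_def s_def l_def)
  have "narrow f z s N m"
    unfolding narrow_def fp fst_conv snd_conv
  proof (intro conjI impI ballI allI sub N(1))
    show "length z \<le> length s" by (simp add: s_def l_def)
    show "supp_len (h j (snd (f y))) \<le> N" if "y \<sqsubset> z" for y j
      using that by (intro N(2)) (auto simp: B_def)
    show "N \<le> m j" for j using m by simp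
    fix v assume v: "v \<in> W \<inter> cyl s"
    show "d cp (g v) \<le> (1/2) ^ length z" using in_O2[OF v] by (auto simp: O2_def O1_def in_mball)
    show "h j (g v) n = h j cp n" if "n < N" for j n using in_O2[OF v] that by (auto simp: O2_def O1_def)
    show "h j (g v) (m j)" for j using in_O2[OF v] m by (auto simp: O2_def)
  qed
  then have "stage f z (s, c)" unfolding stage_def using ne c by auto
  then show ?thesis by blast
qed

lemma ex_scheme: "\<exists>f. \<forall>z. stage f z (f z)"
proof (rule dependent_wf_choice[OF wf_prec])
  fix f g :: "bool list \<Rightarrow> nat list \<times> 'z" and z r
  assume "\<And>y. (y, z) \<in> {(y, z). y \<sqsubset> z} \<Longrightarrow> f y = g y"
  then have eq: "\<And>y. y \<sqsubset> z \<Longrightarrow> f y = g y" by simp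
  then have "z \<noteq> [] \<Longrightarrow> f (pred_Q z) = g (pred_Q z)" using pred_Q_prec by blast
  then show "stage f z r = stage g z r" unfolding stage_def narrow_def using eq by (simp cong: conj_cong)
qed (use ex_stage in auto)

end

text \<open>
  The outcome of the recursion, with the bounds and places of ones as functions of the node.
\<close>
locale cantor_scheme = non_fsigma_map M d W g h D
  for M :: "'z set" and d W g and h :: "'j::finite \<Rightarrow> 'z \<Rightarrow> cantor" and D +
  fixes s :: "bool list \<Rightarrow> nat list" and c :: "bool list \<Rightarrow> 'z" and N :: "bool list \<Rightarrow> nat"
    and m :: "bool list \<Rightarrow> 'j \<Rightarrow> nat"
  assumes core_s: "core \<inter> cyl (s z) \<noteq> {}"
    and adherent_c: "adherent (s z) (c z)"
    and cyl_pred: "z \<in> Q \<Longrightarrow> z \<noteq> [] \<Longrightarrow> cyl (s z) \<subseteq> cyl (s (pred_Q z))"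
    and length_s: "z \<in> Q \<Longrightarrow> length z \<le> length (s z)"
    and N_length: "z \<in> Q \<Longrightarrow> z \<noteq> [] \<Longrightarrow> length z \<le> N z"
    and N_supp_len: "z \<in> Q \<Longrightarrow> z \<noteq> [] \<Longrightarrow> y \<sqsubset> z \<Longrightarrow> supp_len (h j (c y)) \<le> N z"
    and N_le_m: "z \<in> Q \<Longrightarrow> z \<noteq> [] \<Longrightarrow> N z \<le> m z j"
    and near_c: "z \<in> Q \<Longrightarrow> z \<noteq> [] \<Longrightarrow> w \<in> W \<inter> cyl (s z) \<Longrightarrow> d (c (pred_Q z)) (g w) \<le> (1/2) ^ length z"
    and agree: "z \<in> Q \<Longrightarrow> z \<noteq> [] \<Longrightarrow> w \<in> W \<inter> cyl (s z) \<Longrightarrow> n < N z \<Longrightarrow>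
      h j (g w) n = h j (c (pred_Q z)) n"
    and one_m: "z \<in> Q \<Longrightarrow> z \<noteq> [] \<Longrightarrow> w \<in> W \<inter> cyl (s z) \<Longrightarrow> h j (g w) (m z j)"

lemma (in non_fsigma_map) ex_cantor_scheme:
  "\<exists>s c N m. cantor_scheme M d W g h D s c N m"
proof -
  obtain f where f: "\<And>z. stage f z (f z)" using ex_scheme by blast
  have "\<forall>z. \<exists>N m. z \<in> Q \<and> z \<noteq> [] \<longrightarrow> narrow f z (fst (f z)) N m"
    using f unfolding stage_def by blast
  then obtain N m where Nm: "\<And>z. z \<in> Q \<Longrightarrow> z \<noteq> [] \<Longrightarrow> narrow f z (fst (f z)) (N z) (m z)"
    by metis
  have "cantor_scheme M d W g h D (\<lambda>z. fst (f z)) (\<lambda>z. snd (f z)) N m"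
  proof unfold_locales
    fix z
    show "core \<inter> cyl (fst (f z)) \<noteq> {}" "adherent (fst (f z)) (snd (f z))"
      using f[of z] by (auto simp: stage_def)
    show "length z \<le> length (fst (f z))" if "z \<in> Q"
      using Nm[of z] that by (cases "z = []") (auto simp: narrow_def)
    assume z: "z \<in> Q" "z \<noteq> []"
    show "cyl (fst (f z)) \<subseteq> cyl (fst (f (pred_Q z)))"
      using Nm[OF z] by (simp add: narrow_def)
    show "length z \<le> N z" using Nm[OF z] by (simp add: narrow_def)
    show "supp_len (h j (snd (f y))) \<le> N z" if "y \<sqsubset> z" for j y
      using Nm[OF z] that by (auto simp: narrow_def)
  qed (use Nm in \<open>auto simp: narrow_def\<close>)
  then show ?thesis by blast
qed

context cantor_scheme begin

lemma c_in_M: "c z \<in> M" and c_notin_D: "c z \<notin> D"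
  using adherent_c[of z] by (auto simp: adherent_def)

lemma cyl_antimono:
  assumes "v \<in> Q" "z \<in> Q" "init v \<alpha>" "init z \<alpha>" "length v \<le> length z"
  shows "cyl (s z) \<subseteq> cyl (s v)"
  using assms
proof (induction "length z" arbitrary: z rule: less_induct)
  case less
  show ?case
  proof (cases "length v = length z")
    case True
    then have "v = z" using less.prems by (auto simp: init_def list_eq_iff_nth_eq)
    then show ?thesis by simp
  next
    case False
    then have lt: "length v < length z" using less.prems by simp
    then have ne: "z \<noteq> []" by auto
    have "cyl (s (pred_Q z)) \<subseteq> cyl (s v)"
      using less.hyps[of "pred_Q z"] length_pred_Q[OF ne] less.prems ne init_pred_Q
        init_length_le_pred_Q[OF less.prems(1-4) lt] by simp
    then show ?thesis using cyl_pred[OF less.prems(2) ne] by blast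
  qed
qed

text \<open>
  Along an infinite branch the cylinders are nested with lengths tending to infinity, so they have a
  common point, which is in the closed set \<open>W\<close> since all of them meet \<open>W\<close>.
\<close>
lemma branch_point:
  assumes "\<alpha> \<in> P_infinity"
  obtains w where "w \<in> W" "\<And>z. z \<in> Q \<Longrightarrow> init z \<alpha> \<Longrightarrow> w \<in> cyl (s z)"
proof -
  have "\<exists>z. z \<in> Q \<and> init z \<alpha> \<and> n < length z" for n
  proof -
    obtain k where k: "k \<ge> n" "\<alpha> k" using assms notin_P_infinity_iff by blast
    let ?z = "map \<alpha> [0..<Suc k]"
    have "?z \<in> Q" "init ?z \<alpha>" "n < length ?z" using k by (auto simp: Q_iff init_def simp del: upt_Suc) (auto)
    then show ?thesis by blast
  qed
  then obtain e where e: "\<And>n. e n \<in> Q" "\<And>n. init (e n) \<alpha>" "\<And>n. n < length (e n)" by metis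
  have "\<forall>n. \<exists>w. w \<in> core \<inter> cyl (s (e n))" using core_s by blast
  then obtain u where u: "\<And>n. u n \<in> core" "\<And>n. u n \<in> cyl (s (e n))" by (metis IntE)
  \<comment> \<open>The diagonal term is determined: cylinders of deeper nodes fix longer initial segments.\<close>
  define w where "w i = u i i" for i
  have w: "w \<in> cyl (s z)" if z: "z \<in> Q" "init z \<alpha>" for z
    unfolding cyl_def mem_Collect_eq
  proof (intro allI impI)
    fix i assume i: "i < length (s z)"
    show "w i = s z ! i"
    proof (cases "length z \<le> length (e i)")
      case True
      then have "u i \<in> cyl (s z)" using cyl_antimono[OF z(1) e(1) z(2) e(2)] u(2) by blast
      then show ?thesis using i by (simp add: w_def cyl_def)
    next
      case False
      then have sub: "cyl (s z) \<subseteq> cyl (s (e i))" using cyl_antimono[OF e(1) z(1) e(2) z(2)] by simp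
      obtain v where v: "v \<in> cyl (s z)" using core_s[of z] by blast
      have "i < length (s (e i))" using e(3)[of i] length_s[OF e(1)[of i]] by linarith
      then have "v i = s (e i) ! i" "u i i = s (e i) ! i" using sub v u(2)[of i] by (auto simp: cyl_def)
      moreover have "v i = s z ! i" using v i by (simp add: cyl_def)
      ultimately show ?thesis by (simp add: w_def)
    qed
  qed
  have "w \<in> W"
  proof (rule ccontr)
    assume "w \<notin> W"
    then have "w \<in> - W" "open (- W)" using closed_W by auto
    then obtain n where n: "\<And>y. (\<And>i. i < n \<Longrightarrow> y i = w i) \<Longrightarrow> y \<in> - W" using open_contains_cylinder by metis
    have "u n i = w i" if "i < n" for i
    proof -
      have "i < length (s (e n))" using that e(3)[of n] length_s[OF e(1)[of n]] by linarith
      then show ?thesis using w[OF e(1,2)] u(2)[of n] by (simp add: cyl_def)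
    qed
    then have "u n \<in> - W" using n by blast
    then show False using u(1) core_subset by blast
  qed
  then show thesis using that w by blast
qed

text \<open>
  Sequences with infinitely many ones are branches of \<open>Q\<close> and go to the image of the branch point; the
  others are nodes of \<open>Q\<close> and go to the point chosen for the node.
\<close>
definition k :: "cantor \<Rightarrow> 'z" where
  "k \<alpha> = (if \<alpha> \<in> P_infinity
     then g (SOME w. w \<in> W \<and> (\<forall>z\<in>Q. init z \<alpha> \<longrightarrow> w \<in> cyl (s z))) else c (trunc \<alpha>))"

lemma k_zeros_ext: "z \<in> Q \<Longrightarrow> k (zeros_ext z) = c z"
  by (simp add: k_def trunc_zeros_ext)

text \<open>
  All of the Cantor set above \<open>z\<close> is in the closure of the image of the cylinder of \<open>z\<close>, so closed conditions
  imposed on the cylinder hold there.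
\<close>
lemma k_in_M: "k \<alpha> \<in> M"
  and k_near: "z \<in> Q \<Longrightarrow> init z \<alpha> \<Longrightarrow> \<epsilon> > 0 \<Longrightarrow> \<exists>w \<in> W \<inter> cyl (s z). d (k \<alpha>) (g w) < \<epsilon>"
proof -
  have "k \<alpha> \<in> M \<and> (\<forall>z \<epsilon>. z \<in> Q \<and> init z \<alpha> \<and> \<epsilon> > 0 \<longrightarrow> (\<exists>w \<in> W \<inter> cyl (s z). d (k \<alpha>) (g w) < \<epsilon>))"
  proof (cases "\<alpha> \<in> P_infinity")
    case True
    let ?w = "SOME w. w \<in> W \<and> (\<forall>z\<in>Q. init z \<alpha> \<longrightarrow> w \<in> cyl (s z))"
    have "\<exists>w. w \<in> W \<and> (\<forall>z\<in>Q. init z \<alpha> \<longrightarrow> w \<in> cyl (s z))"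
      using branch_point[OF True] by metis
    then have w: "?w \<in> W \<and> (\<forall>z\<in>Q. init z \<alpha> \<longrightarrow> ?w \<in> cyl (s z))" by (rule someI_ex)
    moreover have "k \<alpha> = g ?w" using True by (simp add: k_def)
    moreover have "g ?w \<in> M" using w range_g by blast
    moreover have "\<exists>w \<in> W \<inter> cyl (s z). d (g ?w) (g w) < \<epsilon>" if "z \<in> Q \<and> init z \<alpha> \<and> \<epsilon> > 0" for z \<epsilon>
      using w that \<open>g ?w \<in> M\<close> by (intro bexI[of _ ?w]) auto
    ultimately show ?thesis by simp
  next
    case False
    then have ka: "k \<alpha> = c (trunc \<alpha>)" by (simp add: k_def)
    have "\<exists>w \<in> W \<inter> cyl (s z). d (k \<alpha>) (g w) < \<epsilon>" if z: "z \<in> Q" "init z \<alpha>" "\<epsilon> > 0" for z \<epsilon>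
    proof -
      have "length z \<le> supp_len \<alpha>"
      proof (cases "z = []")
        case False
        then show ?thesis using supp_len_gt[OF \<open>\<alpha> \<notin> P_infinity\<close> init_last[OF z(1) _ z(2)]] by simp
      qed simp
      then have "cyl (s (trunc \<alpha>)) \<subseteq> cyl (s z)"
        using cyl_antimono[OF z(1) trunc_in_Q[OF False] z(2) init_trunc] by simp
      then show ?thesis using adherent_c[of "trunc \<alpha>"] z(3) core_subset ka unfolding adherent_def by (metis IntE IntI subsetD)
    qed
    then show ?thesis using ka c_in_M by auto
  qed
  then show "k \<alpha> \<in> M" "z \<in> Q \<Longrightarrow> init z \<alpha> \<Longrightarrow> \<epsilon> > 0 \<Longrightarrow> \<exists>w \<in> W \<inter> cyl (s z). d (k \<alpha>) (g w) < \<epsilon>"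
    by blast+
qed

lemma g_in_M: "w \<in> W \<Longrightarrow> g w \<in> M"
  using range_g by blast

lemma k_near_c:
  assumes "z \<in> Q" "z \<noteq> []" "init z \<alpha>"
  shows "d (c (pred_Q z)) (k \<alpha>) \<le> (1/2) ^ length z"
proof (rule field_le_epsilon)
  fix \<epsilon> :: real assume "\<epsilon> > 0"
  then obtain w where w: "w \<in> W \<inter> cyl (s z)" "d (k \<alpha>) (g w) < \<epsilon>" using k_near assms by blast
  have "d (c (pred_Q z)) (k \<alpha>) \<le> d (c (pred_Q z)) (g w) + d (g w) (k \<alpha>)"
    using w(1) by (intro triangle c_in_M k_in_M g_in_M) auto
  then show "d (c (pred_Q z)) (k \<alpha>) \<le> (1/2) ^ length z + \<epsilon>"
    using near_c[OF assms(1,2) w(1)] w(2) by (simp add: commute)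
qed

lemma h_k_approx:
  assumes "z \<in> Q" "init z \<alpha>"
  obtains w where "w \<in> W \<inter> cyl (s z)" "h j (g w) n = h j (k \<alpha>) n"
proof -
  let ?O = "{x \<in> M. \<forall>j'. \<forall>n'\<in>{n}. h j' x n' = h j' (k \<alpha>) n'}"
  have "openin mtopology ?O" "k \<alpha> \<in> ?O"
    using openin_h_agree[of "\<lambda>_. {n}"] k_in_M by auto
  then obtain r where r: "r > 0" "mball (k \<alpha>) r \<subseteq> ?O" unfolding openin_mtopology by blast
  obtain w where w: "w \<in> W \<inter> cyl (s z)" "d (k \<alpha>) (g w) < r" using k_near assms r(1) by blast
  then have "g w \<in> mball (k \<alpha>) r" using k_in_M g_in_M by (simp add: in_mball)
  then show thesis using that w(1) r(2) by auto
qed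

lemma h_k_agree:
  assumes "z \<in> Q" "z \<noteq> []" "init z \<alpha>" "n < N z"
  shows "h j (k \<alpha>) n = h j (c (pred_Q z)) n"
  using h_k_approx[OF assms(1,3)] agree[OF assms(1,2) _ assms(4)] by metis

lemma h_k_one:
  assumes "z \<in> Q" "z \<noteq> []" "init z \<alpha>"
  shows "h j (k \<alpha>) (m z j)"
  using h_k_approx[OF assms(1,3)] one_m[OF assms(1,2)] by metis

lemma h_c: "h j (c z) \<notin> P_infinity"
  using h_D c_in_M c_notin_D by blast

text \<open>
  Each node on the branch of \<open>\<alpha>\<close> contributes a one to the image, at a place not smaller than its length.
  So branches go to sequences with infinitely many ones, although the branch points are only known to
  be in \<open>W\<close>.
\<close>
lemma k_P_infinity: "h j (k \<alpha>) \<in> P_infinity \<longleftrightarrow> \<alpha> \<in> P_infinity"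
proof (cases "\<alpha> \<in> P_infinity")
  case True
  have "\<exists>i\<ge>n. h j (k \<alpha>) i" for n
  proof -
    obtain i where i: "i \<ge> n" "\<alpha> i" using True notin_P_infinity_iff by blast
    let ?z = "map \<alpha> [0..<Suc i]"
    have z: "?z \<in> Q" "init ?z \<alpha>" "?z \<noteq> []" using i by (auto simp: Q_iff init_def simp del: upt_Suc) (auto)
    have "n \<le> m ?z j" using i N_length[OF z(1,3)] N_le_m[OF z(1,3), of j] by simp
    then show ?thesis using h_k_one[OF z(1,3,2)] by blast
  qed
  then show ?thesis using True notin_P_infinity_iff by blast
next
  case False
  then show ?thesis using h_c by (simp add: k_def)
qed

lemma h_c_supp_len: "z \<in> Q \<Longrightarrow> z \<noteq> [] \<Longrightarrow> m z j < supp_len (h j (c z))"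
  using supp_len_gt[OF h_c] h_k_one[of z "zeros_ext z" j] init_zeros_ext k_zeros_ext by metis

lemma spreading_c: "spreading (\<lambda>z. trunc (h j (c z)))"
proof
  show "trunc (h j (c z)) \<in> Q" for z using trunc_in_Q h_c .
  fix z assume z: "z \<in> Q" "z \<noteq> []"
  show "\<exists>N. (\<forall>y\<in>Q. y \<sqsubset> z \<longrightarrow> length (trunc (h j (c y))) \<le> N) \<and> N < length (trunc (h j (c z))) \<and>
            (\<forall>n<N. zeros_ext (trunc (h j (c z))) n = zeros_ext (trunc (h j (c (pred_Q z)))) n)"
    using N_supp_len[OF z] h_c_supp_len[OF z, of j] N_le_m[OF z, of j]
      h_k_agree[OF z init_zeros_ext] k_zeros_ext[OF z(1)]
    by (intro exI[of _ "N z"]) (auto simp: zeros_ext_trunc h_c)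
qed

text \<open>
  Where \<open>\<alpha>\<close> and \<open>\<beta>\<close> part, \<open>\<beta>\<close> enters the cone of some child \<open>z\<close> of a node \<open>p\<close>, whereas \<open>\<alpha>\<close> equals \<open>p 0\<^sup>\<omega>\<close> or
  enters the cone of a longer child \<open>y\<close>. At the place of the one attached to \<open>z\<close>, the image of \<open>\<alpha>\<close> agrees
  with that of \<open>p\<close>, which is zero there.
\<close>
lemma inj_h_k: "inj (\<lambda>\<alpha>. h j (k \<alpha>))"
proof -
  have *: "h j (k \<alpha>) \<noteq> h j (k \<beta>)" if n: "\<not> \<alpha> n" "\<beta> n" "\<And>i. i < n \<Longrightarrow> \<alpha> i = \<beta> i" for \<alpha> \<beta> n
  proof -
    define z where "z = map \<beta> [0..<Suc n]"
    have z: "z \<in> Q" "z \<noteq> []" "init z \<beta>" "length z = Suc n"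
      using n by (auto simp: z_def Q_iff init_def simp del: upt_Suc) (auto)
    let ?p = "pred_Q z"
    have p: "?p \<in> Q" "length ?p \<le> n" using z length_pred_Q[OF z(2)] by auto
    have initp: "init ?p \<alpha>" using init_pred_Q[OF z(3)] n(3) p(2) by (auto simp: init_def)
    have zeros: "\<not> \<alpha> i" if "length ?p \<le> i" "i \<le> n" for i
    proof (cases "i = n")
      case False
      then have "\<not> z ! i" using nth_Q_after_pred_Q[OF z(1) that(1)] that z(4) by simp
      then show ?thesis using False n(3) z that by (simp add: init_def)
    qed (use n in simp)
    have mp: "supp_len (h j (c ?p)) \<le> m z j"
      using N_supp_len[OF z(1,2) pred_Q_prec[OF z(2)], of j] N_le_m[OF z(1,2), of j] by linarith
    have "\<not> h j (k \<alpha>) (m z j)"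
    proof (cases "\<exists>i\<ge>length ?p. \<alpha> i")
      case False
      then have "\<alpha> = zeros_ext ?p" using initp by (auto simp: zeros_ext_def init_def fun_eq_iff not_le)
      then show ?thesis using k_zeros_ext[OF p(1)] supp_len_bound[OF h_c mp] by simp
    next
      case True
      then obtain i y where y: "y \<in> Q" "y \<noteq> []" "pred_Q y = ?p" "init y \<alpha>"
        using next_one[OF p(1) initp] by metis
      have "length ?p \<le> length y - 1" using length_pred_Q[OF y(2)] y(3) by simp
      then have "n < length y - 1" using zeros[of "length y - 1"] init_last[OF y(1,2,4)] by linarith
      then have "Suc n < length y" by linarith
      then have "z \<sqsubset> y" using z(4) by (simp add: prec_def)
      then have "m z j < N y" using N_supp_len[OF y(1,2), of z j] h_c_supp_len[OF z(1,2), of j] by linarith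
      then show ?thesis using h_k_agree[OF y(1,2,4)] y(3) supp_len_bound[OF h_c mp] by simp
    qed
    then show ?thesis using h_k_one[OF z(1-3), of j] by metis
  qed
  show ?thesis
  proof (rule injI, rule ccontr)
    fix \<alpha> \<beta> assume eq: "h j (k \<alpha>) = h j (k \<beta>)" and "\<alpha> \<noteq> \<beta>"
    then have "\<exists>n. \<alpha> n \<noteq> \<beta> n" by auto
    then obtain n where n: "\<alpha> n \<noteq> \<beta> n" "\<And>i. i < n \<Longrightarrow> \<alpha> i = \<beta> i"
      using exists_least_iff[of "\<lambda>n. \<alpha> n \<noteq> \<beta> n"] by auto
    show False
    proof (cases "\<alpha> n")
      case True
      then show False using *[of \<beta> n \<alpha>] n eq by simp
    next
      case False
      then show False using *[of \<alpha> n \<beta>] n eq by simp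
    qed
  qed
qed

text \<open>
  At a branch, use a long node on it. At a node \<open>z\<close>, sequences near \<open>z 0\<^sup>\<omega>\<close> are in the cones of long
  children of \<open>z\<close>, whose images are near the point chosen for \<open>z\<close>.
\<close>
lemma continuous_k: "continuous_map euclidean mtopology k"
proof -
  have "\<exists>n. \<forall>\<beta>. (\<forall>i<n. \<beta> i = \<alpha> i) \<longrightarrow> d (k \<alpha>) (k \<beta>) < \<epsilon>" if "\<epsilon> > 0" for \<alpha> \<epsilon>
  proof -
    obtain n0 where n0: "(1/2) ^ n0 < \<epsilon> / 2" using \<open>\<epsilon> > 0\<close> real_arch_pow_inv[of "\<epsilon>/2" "1/2"] by auto
    have small: "(1/2::real) ^ l < \<epsilon> / 2" if "n0 \<le> l" for l
      by (rule le_less_trans[OF power_decreasing[OF that] n0]) auto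
    show ?thesis
    proof (cases "\<alpha> \<in> P_infinity")
      case True
      then obtain i where i: "i \<ge> n0" "\<alpha> i" using notin_P_infinity_iff by blast
      define z where "z = map \<alpha> [0..<Suc i]"
      have z: "z \<in> Q" "z \<noteq> []" "init z \<alpha>" "length z = Suc i"
        using i by (auto simp: z_def Q_iff init_def simp del: upt_Suc) (auto)
      have "d (k \<alpha>) (k \<beta>) < \<epsilon>" if "\<forall>l<Suc i. \<beta> l = \<alpha> l" for \<beta>
      proof -
        have "init z \<beta>" using z that by (simp add: init_def)
        then have "d (c (pred_Q z)) (k \<beta>) < \<epsilon> / 2" "d (c (pred_Q z)) (k \<alpha>) < \<epsilon> / 2"
          using k_near_c[OF z(1,2), of \<beta>] k_near_c[OF z(1,2), of \<alpha>] z(3,4) small[of "Suc i"] i(1)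
          by simp_all
        moreover have "d (k \<alpha>) (k \<beta>) \<le> d (k \<alpha>) (c (pred_Q z)) + d (c (pred_Q z)) (k \<beta>)"
          by (intro triangle k_in_M c_in_M)
        ultimately show ?thesis by (simp add: commute)
      qed
      then show ?thesis by blast
    next
      case False
      let ?z = "trunc \<alpha>" and ?n = "max n0 (supp_len \<alpha>)"
      have ka: "k \<alpha> = c ?z" using False by (simp add: k_def)
      have "d (k \<alpha>) (k \<beta>) < \<epsilon>" if b: "\<forall>l<?n. \<beta> l = \<alpha> l" for \<beta>
      proof (cases "\<beta> = \<alpha>")
        case True
        then show ?thesis using k_in_M \<open>\<epsilon> > 0\<close> by simp
      next
        case neq: False
        then obtain i where i: "\<beta> i \<noteq> \<alpha> i" by auto
        then have "i \<ge> ?n" using b not_le by blast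
        then have bi: "\<beta> i" "i \<ge> length ?z" using i supp_len_bound[OF False, of i] by auto
        have initb: "init ?z \<beta>" using b by (simp add: init_def trunc_def)
        obtain y where y: "y \<in> Q" "y \<noteq> []" "pred_Q y = ?z" "init y \<beta>"
          using next_one[OF trunc_in_Q[OF False] initb bi(2,1)] by metis
        have "n0 \<le> length y"
        proof (rule ccontr)
          assume "\<not> n0 \<le> length y"
          then have "length y - 1 < ?n" by linarith
          then have "\<alpha> (length y - 1)" using init_last[OF y(1,2,4)] b by auto
          then have "length y - 1 < length ?z" using supp_len_gt[OF False] by simp
          then show False using length_pred_Q[OF y(2)] y(3) by simp
        qed
        then have "d (c ?z) (k \<beta>) < \<epsilon> / 2" using k_near_c[OF y(1,2,4)] y(3) small by (metis le_less_trans)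
        then show ?thesis using ka \<open>\<epsilon> > 0\<close> by simp
      qed
      then show ?thesis by blast
    qed
  qed
  note cont = this
  show ?thesis
    unfolding continuous_map_def
  proof (intro conjI allI impI)
    show "k \<in> topspace euclidean \<rightarrow> topspace mtopology" using k_in_M by simp
    fix U assume U: "openin mtopology U"
    have "\<exists>T. open T \<and> \<alpha> \<in> T \<and> T \<subseteq> {x. k x \<in> U}" if ka: "k \<alpha> \<in> U" for \<alpha>
    proof -
      obtain r where r: "r > 0" "mball (k \<alpha>) r \<subseteq> U" using U ka unfolding openin_mtopology by blast
      obtain n where "\<And>\<beta>. (\<forall>i<n. \<beta> i = \<alpha> i) \<Longrightarrow> d (k \<alpha>) (k \<beta>) < r" using cont[OF r(1)] by blast
      then have "{y. \<forall>i<n. y i = \<alpha> i} \<subseteq> {x. k x \<in> U}" using r(2) k_in_M by (auto simp: in_mball subset_iff)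
      then show ?thesis using open_cylinder[of n \<alpha>] by blast
    qed
    then have "open {x. k x \<in> U}" by (subst open_subopen) auto
    then show "openin euclidean {x \<in> topspace euclidean. k x \<in> U}" by simp
  qed
qed

end

text \<open>
  A version of Hurewicz's theorem on non-\<open>F\<^sub>\<sigma>\<close> sets in which the Cantor set is in addition
  index-preserving, simultaneously for finitely many maps. Several maps are needed to compare two
  different graphs.
\<close>
theorem cantor_copy:
  fixes Z :: "'z topology" and g :: "(nat \<Rightarrow> nat) \<Rightarrow> 'z" and h :: "'j::finite \<Rightarrow> 'z \<Rightarrow> cantor"
  assumes "metrizable_space Z" "closed W" "continuous_map (top_of_set W) Z g" "g ` W = topspace Z"
    and "\<And>j. continuous_map Z euclidean (h j)"
    and "\<And>j x. x \<in> topspace Z \<Longrightarrow> h j x \<in> P_infinity \<longleftrightarrow> x \<in> D"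
    and "D \<subseteq> topspace Z" "\<not> fsigma_in Z D"
  obtains k where "continuous_map euclidean Z k" "\<And>j. inj (\<lambda>\<alpha>. h j (k \<alpha>))"
    "\<And>j \<alpha>. h j (k \<alpha>) \<in> P_infinity \<longleftrightarrow> \<alpha> \<in> P_infinity"
    "\<And>j z t. z \<in> Q \<Longrightarrow> t \<in> Q \<Longrightarrow>
       idx (trunc (h j (k (zeros_ext z)))) (trunc (h j (k (zeros_ext t)))) = idx z t"
proof -
  obtain M d where Md: "Metric_space M d" "Z = Metric_space.mtopology M d"
    using assms(1) unfolding metrizable_space_def by blast
  interpret Metric_space M d by fact
  interpret non_fsigma_map M d W g h D
    by unfold_locales (use assms Md(2) in auto)
  obtain s c N m where "cantor_scheme M d W g h D s c N m" using ex_cantor_scheme by blast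
  then interpret cantor_scheme M d W g h D s c N m .
  show thesis
    by (rule that[of k])
      (use continuous_k inj_h_k k_P_infinity spreading.idx_spread[OF spreading_c] Md(2) in
        \<open>auto simp: k_zeros_ext\<close>)
qed

section \<open>The relations and graphs, and maps respecting them\<close>

lemma R_rel_iff:
  "(x, y) \<in> R_rel \<beta> \<longleftrightarrow> x \<in> P_infinity \<and> x = y \<or>
     x \<notin> P_infinity \<and> y \<notin> P_infinity \<and> x \<noteq> y \<and> \<beta> (idx (trunc x) (trunc y))"
proof
  assume "(x, y) \<in> R_rel \<beta>"
  then show "x \<in> P_infinity \<and> x = y \<or>
     x \<notin> P_infinity \<and> y \<notin> P_infinity \<and> x \<noteq> y \<and> \<beta> (idx (trunc x) (trunc y))"
    by (auto simp: R_rel_def trunc_zeros_ext zeros_ext_eq_iff)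
next
  assume "x \<in> P_infinity \<and> x = y \<or>
     x \<notin> P_infinity \<and> y \<notin> P_infinity \<and> x \<noteq> y \<and> \<beta> (idx (trunc x) (trunc y))"
  moreover have "(x, y) \<in> R_rel \<beta>"
    if "x \<notin> P_infinity" "y \<notin> P_infinity" "x \<noteq> y" "\<beta> (idx (trunc x) (trunc y))"
  proof -
    have "x = zeros_ext (trunc x)" "y = zeros_ext (trunc y)" using zeros_ext_trunc that by auto
    moreover from this have "trunc x \<noteq> trunc y" using that(3) by metis
    moreover have "trunc x \<in> Q" "trunc y \<in> Q" using trunc_in_Q that by auto
    ultimately show ?thesis using that(4) unfolding R_rel_def by blast
  qed
  ultimately show "(x, y) \<in> R_rel \<beta>" by (auto simp: R_rel_def)
qed

lemma R_rel_sym: "(x, y) \<in> R_rel \<beta> \<longleftrightarrow> (y, x) \<in> R_rel \<beta>"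
  using idx_commute[OF trunc_in_Q trunc_in_Q, of x y] by (auto simp: R_rel_iff)

lemma G_graph_iff: "(p, q) \<in> G_graph \<beta> \<longleftrightarrow> fst p \<noteq> fst q \<and> (snd p, snd q) \<in> R_rel \<beta>"
  using R_rel_sym[of "snd p" "snd q" \<beta>]
  by (cases p; cases q) (auto simp: G_graph_def E_rel_def)

text \<open>
  Being independent of \<open>\<beta>\<close>, this notion serves all the relations \<open>R\<^sub>\<beta>\<close> at once.
\<close>
definition faithful :: "(cantor \<Rightarrow> cantor) \<Rightarrow> bool" where
  "faithful \<theta> \<longleftrightarrow> inj \<theta> \<and> (\<forall>\<alpha>. \<theta> \<alpha> \<in> P_infinity \<longleftrightarrow> \<alpha> \<in> P_infinity) \<and>
     (\<forall>z\<in>Q. \<forall>t\<in>Q. idx (trunc (\<theta> (zeros_ext z))) (trunc (\<theta> (zeros_ext t))) = idx z t)"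

lemma faithful_R_rel:
  assumes "faithful \<theta>"
  shows "(\<theta> x, \<theta> y) \<in> R_rel \<beta> \<longleftrightarrow> (x, y) \<in> R_rel \<beta>"
proof -
  have "idx (trunc (\<theta> x)) (trunc (\<theta> y)) = idx (trunc x) (trunc y)" if "x \<notin> P_infinity" "y \<notin> P_infinity"
  proof -
    have "idx (trunc (\<theta> (zeros_ext (trunc x)))) (trunc (\<theta> (zeros_ext (trunc y)))) = idx (trunc x) (trunc y)"
      using assms trunc_in_Q[OF that(1)] trunc_in_Q[OF that(2)] unfolding faithful_def by blast
    then show ?thesis using that by (simp add: zeros_ext_trunc)
  qed
  moreover have "\<theta> x = \<theta> y \<longleftrightarrow> x = y" "\<And>a. \<theta> a \<in> P_infinity \<longleftrightarrow> a \<in> P_infinity"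
    using assms by (auto simp: faithful_def inj_eq)
  ultimately show ?thesis
    by (cases "x \<in> P_infinity"; cases "y \<in> P_infinity") (simp_all add: R_rel_iff)
qed

section \<open>Cantor sets in the square of an analytic space\<close>

text \<open>
  A nonempty analytic space \<open>X\<close> is a continuous image of the Baire space, hence so is its square, by
  splitting a sequence into its even and odd terms; the closed set \<open>Z\<close> is then the image of a closed set.
\<close>
lemma cantor_copy_in_square:
  fixes X :: "'a topology" and h :: "'j::finite \<Rightarrow> 'a \<times> 'a \<Rightarrow> cantor"
  assumes X: "analytic_space X" and Z: "closedin (prod_topology X X) Z"
    and h: "\<And>j. continuous_map (subtopology (prod_topology X X) Z) euclidean (h j)"
    and hD: "\<And>j p. p \<in> Z \<Longrightarrow> h j p \<in> P_infinity \<longleftrightarrow> p \<in> D"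
    and D: "D \<subseteq> Z" "\<not> fsigma_in (prod_topology X X) D"
  obtains k where "continuous_map euclidean (prod_topology X X) k" "\<And>\<alpha>. k \<alpha> \<in> Z"
    "\<And>j. faithful (\<lambda>\<alpha>. h j (k \<alpha>))"
proof -
  have "D \<noteq> {}" using D(2) by auto
  then have ne: "topspace X \<noteq> {}" using D(1) closedin_subset[OF Z] by fastforce
  obtain P :: "cantor topology" and A where PA: "A \<subseteq> topspace P" "analytic_in P A"
    "X homeomorphic_space subtopology P A"
    using X unfolding analytic_space_def by blast
  then obtain r r' where r: "homeomorphic_maps X (subtopology P A) r r'"
    unfolding homeomorphic_space_def by blast
  have topA: "topspace (subtopology P A) = A" using PA(1) by auto
  have r': "continuous_map (subtopology P A) X r'" using r by (simp add: homeomorphic_maps_def)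
  have "r' ` A = topspace X"
  proof
    show "r' ` A \<subseteq> topspace X" using continuous_map_image_subset_topspace[OF r'] topA by simp
    show "topspace X \<subseteq> r' ` A"
    proof
      fix x assume x: "x \<in> topspace X"
      have "continuous_map X (subtopology P A) r" "r' (r x) = x" using r x by (auto simp: homeomorphic_maps_def)
      moreover from this have "r x \<in> A" using continuous_map_image_subset_topspace[of X _ r] topA x by blast
      ultimately show "x \<in> r' ` A" by force
    qed
  qed
  note r' = r' this
  have "A \<noteq> {}" using ne r'(2) by blast
  then obtain q0 where q0: "continuous_map (euclidean :: (nat \<Rightarrow> nat) topology) P q0" "range q0 = A"
    using PA(2) unfolding analytic_in_def by blast
  define q where "q = r' \<circ> q0"
  have "continuous_map euclidean (subtopology P A) q0"
    using q0 by (auto simp: continuous_map_in_subtopology)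
  then have q: "continuous_map euclidean X q" "range q = topspace X"
    using r' q0(2) by (auto simp: q_def intro: continuous_map_compose)
  define g where "g w = (q (\<lambda>i. w (2 * i)), q (\<lambda>i. w (2 * i + 1)))" for w :: "nat \<Rightarrow> nat"
  have sub: "continuous_on UNIV (\<lambda>(w :: nat \<Rightarrow> nat) i. w (e i))" for e :: "nat \<Rightarrow> nat"
    by (intro continuous_on_coordinatewise_then_product continuous_on_product_coordinates)
  have qe: "continuous_map euclidean X (\<lambda>w. q (\<lambda>i. w (e i)))" for e :: "nat \<Rightarrow> nat"
    using continuous_map_compose[OF _ q(1), of euclidean "\<lambda>w i. w (e i)"] sub[of e] by (simp add: o_def)
  have g: "continuous_map euclidean (prod_topology X X) g"
    unfolding g_def continuous_map_paired using qe[of "\<lambda>i. 2 * i"] qe[of "\<lambda>i. 2 * i + 1"] by blast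
  define W where "W = {w. g w \<in> Z}"
  have W: "closed W" using closedin_continuous_map_preimage[OF g Z] by (simp add: W_def)
  have Zsub: "Z \<subseteq> topspace X \<times> topspace X" using closedin_subset[OF Z] by simp
  have "g ` W = Z"
  proof
    show "Z \<subseteq> g ` W"
    proof
      fix p assume p: "p \<in> Z"
      have "fst p \<in> range q" "snd p \<in> range q" using p Zsub q(2) by auto
      then obtain u v where uv: "q u = fst p" "q v = snd p" by (metis rangeE)
      define w where "w i = (if even i then u (i div 2) else v (i div 2))" for i
      have "g w = p" using uv by (simp add: g_def w_def)
      then show "p \<in> g ` W" using p by (auto simp: W_def)
    qed
  qed (auto simp: W_def)
  let ?T = "subtopology (prod_topology X X) Z"
  have top: "topspace ?T = Z" using Zsub by auto
  have gW: "continuous_map (top_of_set W) ?T g"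
    using continuous_map_from_subtopology[OF g] by (auto simp: continuous_map_in_subtopology W_def)
  have metr: "metrizable_space ?T"
    using X by (auto simp: analytic_space_def metrizable_space_prod_topology intro: metrizable_space_subtopology)
  \<comment> \<open>A closed subspace has no new \<open>F\<^sub>\<sigma>\<close> sets.\<close>
  have nf: "\<not> fsigma_in ?T D"
    using D fsigma_in_fsigma_subtopology[OF closed_imp_fsigma_in[OF Z]] by blast
  obtain k where k: "continuous_map euclidean ?T k" "\<And>j. inj (\<lambda>\<alpha>. h j (k \<alpha>))"
    "\<And>j \<alpha>. h j (k \<alpha>) \<in> P_infinity \<longleftrightarrow> \<alpha> \<in> P_infinity"
    "\<And>j z t. z \<in> Q \<Longrightarrow> t \<in> Q \<Longrightarrow>
       idx (trunc (h j (k (zeros_ext z)))) (trunc (h j (k (zeros_ext t)))) = idx z t"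
  proof (rule cantor_copy[where h = h])
    show "continuous_map ?T euclidean (h j)" for j by (rule h)
    show "metrizable_space ?T" "\<not> fsigma_in ?T D" by fact+
    show "closed W" "continuous_map (top_of_set W) ?T g" "g ` W = topspace ?T" "D \<subseteq> topspace ?T"
      using W gW \<open>g ` W = Z\<close> D(1) unfolding top by auto
    show "h j p \<in> P_infinity \<longleftrightarrow> p \<in> D" if "p \<in> topspace ?T" for j p
      using hD that unfolding top by blast
  qed blast
  show thesis
  proof (rule that)
    show "continuous_map euclidean (prod_topology X X) k" "k \<alpha> \<in> Z" for \<alpha>
      using k(1) by (auto simp: continuous_map_in_subtopology)
    show "faithful (\<lambda>\<alpha>. h j (k \<alpha>))" for j using k by (simp add: faithful_def)
  qed
qed

section \<open>Minimality\<close>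

text \<open>
  For a reduction \<open>f\<close> to one of the graphs, this is the reduced graph up to reversal and a countable set.
\<close>
definition diagonal_part :: "'a topology \<Rightarrow> ('a \<Rightarrow> bool \<times> cantor) \<Rightarrow> ('a \<times> 'a) set" where
  "diagonal_part X f = {(x, y) \<in> topspace X \<times> topspace X.
     \<not> fst (f x) \<and> fst (f y) \<and> snd (f x) = snd (f y) \<and> snd (f x) \<in> P_infinity}"

text \<open>
  An edge of \<open>G\<^sub>\<beta>\<close> either is vertical above a point of \<^const>\<open>P_infinity\<close> or has both ends above
  the countable complement of it.
\<close>
lemma countable_off_diagonal:
  assumes "inj_on f (topspace X)"
  shows "countable {(x, y) \<in> topspace X \<times> topspace X. (f x, f y) \<in> G_graph \<beta> \<and> snd (f x) \<notin> P_infinity}"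
    (is "countable ?K")
proof -
  have "map_prod f f ` ?K \<subseteq> (UNIV \<times> - P_infinity) \<times> (UNIV \<times> - P_infinity)"
    by (force simp: G_graph_iff R_rel_iff mem_Times_iff)
  then have "countable (map_prod f f ` ?K)"
    by (rule countable_subset) (use countable_compl_P_infinity in auto)
  moreover have "inj_on (map_prod f f) ?K"
    using assms by (auto simp: inj_on_def)
  ultimately show ?thesis by (rule countable_image_inj_on)
qed

text \<open>
  The pulled back graph consists of the diagonal part, its reverse, and a countable set.
\<close>
lemma diagonal_part_not_fsigma:
  assumes X: "metrizable_space X" and f: "inj_on f (topspace X)"
    and R: "R = {(x, y) \<in> topspace X \<times> topspace X. (f x, f y) \<in> G_graph \<beta>}"
    and nf: "\<not> fsigma_in (prod_topology X X) R"
  shows "\<not> fsigma_in (prod_topology X X) (diagonal_part X f)"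
proof
  let ?A = "diagonal_part X f"
  let ?K = "{(x, y) \<in> topspace X \<times> topspace X. (f x, f y) \<in> G_graph \<beta> \<and> snd (f x) \<notin> P_infinity}"
  assume A: "fsigma_in (prod_topology X X) ?A"
  have "t1_space (prod_topology X X)"
    using X by (intro metrizable_imp_t1_space) (simp add: metrizable_space_prod_topology)
  then have K: "fsigma_in (prod_topology X X) ?K"
    using countable_off_diagonal[OF f] by (intro fsigma_in_countable) auto
  have "continuous_map (prod_topology X X) (prod_topology X X) (\<lambda>p. (snd p, fst p))"
    by (simp add: continuous_map_paired continuous_map_fst continuous_map_snd)
  from fsigma_in_continuous_preimage[OF this A]
  have "fsigma_in (prod_topology X X) (?A \<union> {p \<in> topspace (prod_topology X X). (snd p, fst p) \<in> ?A} \<union> ?K)"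
    by (intro fsigma_in_Un A K)
  moreover have "?A \<union> {p \<in> topspace (prod_topology X X). (snd p, fst p) \<in> ?A} \<union> ?K = R"
    unfolding R diagonal_part_def by (auto simp: G_graph_iff R_rel_iff)
  ultimately show False using nf by simp
qed

lemma closed_diagonal_pairs:
  "closed {(p, q). \<not> fst p \<and> fst q \<and> snd p = snd (q :: bool \<times> cantor)}"
proof -
  have "closed {r :: (bool \<times> cantor) \<times> (bool \<times> cantor). fst (fst r) = False \<and> fst (snd r) = True \<and> snd (fst r) = snd (snd r)}"
    by (intro closed_Collect_conj closed_Collect_eq_cantor closed_Collect_eq continuous_intros)
  then show ?thesis by (simp add: case_prod_unfold fun_eq_iff)
qed

text \<open>
  Follow the Cantor set of pairs \<open>k \<alpha>\<close> with the first coordinate on the side \<open>0\<close> and with the second one on the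
  side \<open>1\<close>. Composed with \<open>f\<close> this is \<open>(\<epsilon>,\<alpha>) \<mapsto> (\<epsilon>,\<theta> \<alpha>)\<close> with \<open>\<theta>\<close> faithful, hence it is injective and
  preserves edges and non-edges.
\<close>
lemma G_graph_minimal:
  assumes XR: "non_Sigma02_graph X R" and emb: "embeds_c X R D_space (G_graph \<beta>)"
  shows "embeds_c D_space (G_graph \<beta>) X R"
proof -
  obtain f where f: "continuous_map X D_space f" "inj_on f (topspace X)"
    and R: "R = {(x, y) \<in> topspace X \<times> topspace X. (f x, f y) \<in> G_graph \<beta>}"
    using emb unfolding embeds_c_def by blast
  have X: "analytic_space X" "metrizable_space X" "\<not> fsigma_in (prod_topology X X) R"
    using XR by (auto simp: non_Sigma02_graph_def analytic_space_def)
  define Z where "Z = {p \<in> topspace (prod_topology X X). (f (fst p), f (snd p)) \<in>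
     {(p, q). \<not> fst p \<and> fst q \<and> snd p = snd q}}"
  have cfst: "continuous_map (prod_topology X X) D_space (\<lambda>p. f (fst p))"
    using continuous_map_compose[OF continuous_map_fst f(1)] by (simp add: o_def)
  have csnd: "continuous_map (prod_topology X X) D_space (\<lambda>p. f (snd p))"
    using continuous_map_compose[OF continuous_map_snd f(1)] by (simp add: o_def)
  have "continuous_map (prod_topology X X) (prod_topology D_space D_space) (\<lambda>p. (f (fst p), f (snd p)))"
    unfolding continuous_map_paired using cfst csnd by blast
  then have Z: "closedin (prod_topology X X) Z"
    unfolding Z_def using closed_diagonal_pairs
    by (intro closedin_continuous_map_preimage[where Y = euclidean]) auto
  define h where "h (j :: unit) p = snd (f (fst p))" for j and p :: "'a \<times> 'a"
  have "continuous_map D_space euclidean snd" by (simp add: continuous_on_snd)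
  from continuous_map_compose[OF cfst this] have "continuous_map (prod_topology X X) euclidean (h j)" for j
    by (simp add: o_def h_def[abs_def])
  then have h: "continuous_map (subtopology (prod_topology X X) Z) euclidean (h j)" for j
    by (rule continuous_map_from_subtopology)
  obtain k where k: "continuous_map euclidean (prod_topology X X) k" "\<And>\<alpha>. k \<alpha> \<in> Z"
    and faithful: "\<And>j. faithful (\<lambda>\<alpha>. h j (k \<alpha>))"
  proof (rule cantor_copy_in_square[where h = h, OF X(1) Z h])
    show "h j p \<in> P_infinity \<longleftrightarrow> p \<in> diagonal_part X f" if "p \<in> Z" for j p
      using that by (auto simp: h_def Z_def diagonal_part_def)
    show "diagonal_part X f \<subseteq> Z" by (auto simp: Z_def diagonal_part_def)
    show "\<not> fsigma_in (prod_topology X X) (diagonal_part X f)"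
      using diagonal_part_not_fsigma[OF X(2) f(2) R X(3)] .
  qed blast
  define \<theta> where "\<theta> \<alpha> = snd (f (fst (k \<alpha>)))" for \<alpha>
  \<comment> \<open>The reduction of \<open>G\<^sub>\<beta>\<close> to \<open>R\<close>.\<close>
  define e where "e p = (if fst p then snd (k (snd p)) else fst (k (snd p)))" for p :: "bool \<times> cantor"
  have \<theta>: "faithful \<theta>" using faithful by (simp add: \<theta>_def[abs_def] h_def)
  have fe: "f (e p) = (fst p, \<theta> (snd p))" for p
    using k(2)[of "snd p"] by (cases "fst p") (auto simp: e_def Z_def \<theta>_def prod_eq_iff)
  have eX: "e p \<in> topspace X" for p
    using k(2)[of "snd p"] by (auto simp: e_def Z_def)
  have fk: "continuous_map euclidean X (\<lambda>\<alpha>. fst (k \<alpha>))" and sk: "continuous_map euclidean X (\<lambda>\<alpha>. snd (k \<alpha>))"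
    using continuous_map_compose[OF k(1) continuous_map_fst] continuous_map_compose[OF k(1) continuous_map_snd]
    by (simp_all add: o_def)
  have "continuous_map D_space X e"
    unfolding continuous_map_def
  proof (intro conjI allI impI)
    fix U assume U: "openin X U"
    have "open {\<alpha>. fst (k \<alpha>) \<in> U}" "open {\<alpha>. snd (k \<alpha>) \<in> U}"
      using openin_continuous_map_preimage[OF fk U] openin_continuous_map_preimage[OF sk U] by simp_all
    then have "open ({False} \<times> {\<alpha>. fst (k \<alpha>) \<in> U} \<union> {True} \<times> {\<alpha>. snd (k \<alpha>) \<in> U})"
      by (intro open_Un open_Times) (auto simp: open_discrete)
    moreover have "{False} \<times> {\<alpha>. fst (k \<alpha>) \<in> U} \<union> {True} \<times> {\<alpha>. snd (k \<alpha>) \<in> U} = {p. e p \<in> U}"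
      by (auto simp: e_def split: if_splits)
    ultimately show "openin D_space {x \<in> topspace D_space. e x \<in> U}" by simp
  qed (use eX in simp)
  moreover have "inj e"
  proof (rule injI)
    fix p q assume "e p = e q"
    then have "(fst p, \<theta> (snd p)) = (fst q, \<theta> (snd q))" using fe by metis
    then show "p = q" using \<theta> by (auto simp: faithful_def inj_eq prod_eq_iff)
  qed
  moreover have "(p, q) \<in> G_graph \<beta> \<longleftrightarrow> (e p, e q) \<in> R" for p q
    unfolding R using eX faithful_R_rel[OF \<theta>] by (simp add: fe G_graph_iff)
  ultimately show ?thesis unfolding embeds_c_def by (intro exI[of _ e]) auto
qed

section \<open>Topological and descriptive properties of the graphs\<close>

lemma homeomorphic_D_space: "D_space homeomorphic_space (euclidean :: cantor topology)"
proof -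
  have 1: "continuous_on UNIV (\<lambda>p :: bool \<times> cantor. case_nat (fst p) (snd p))"
  proof (rule continuous_on_coordinatewise_then_product)
    fix i show "continuous_on UNIV (\<lambda>p :: bool \<times> cantor. case_nat (fst p) (snd p) i)"
    proof (cases i)
      case (Suc n)
      have "continuous_on UNIV (\<lambda>p :: bool \<times> cantor. snd p n)"
        by (rule continuous_on_product_then_coordinatewise) (intro continuous_intros)
      then show ?thesis using Suc by simp
    qed (simp add: continuous_on_fst)
  qed
  have 2: "continuous_on UNIV (\<lambda>\<gamma> :: cantor. (\<gamma> 0, \<lambda>n. \<gamma> (Suc n)))"
    by (intro continuous_intros continuous_on_coordinatewise_then_product continuous_on_product_coordinates)
  have "homeomorphic_maps D_space (euclidean :: cantor topology) (\<lambda>p. case_nat (fst p) (snd p)) (\<lambda>\<gamma>. (\<gamma> 0, \<lambda>n. \<gamma> (Suc n)))"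
    unfolding homeomorphic_maps_def using 1 2 by (auto simp: fun_eq_iff split: nat.split)
  then show ?thesis unfolding homeomorphic_space_def by blast
qed

lemma analytic_D_space: "analytic_space D_space"
  unfolding analytic_space_def
proof (intro conjI exI)
  show "separable_space D_space" "metrizable_space D_space"
    using homeomorphic_separable_space[OF homeomorphic_D_space] separable_cantor
      homeomorphic_metrizable_space[OF homeomorphic_D_space]
      completely_metrizable_imp_metrizable_space[OF completely_metrizable_cantor] by auto
  show "Polish_space (euclidean :: cantor topology)"
    using separable_cantor completely_metrizable_cantor by (simp add: Polish_space_def)
  show "analytic_in (euclidean :: cantor topology) UNIV"
    unfolding analytic_in_def
  proof (intro disjI2 exI conjI)
    have "continuous_on UNIV (\<lambda>w :: nat \<Rightarrow> nat. 0 < w n)" for n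
      by (rule continuous_on_compose2[of UNIV "\<lambda>i :: nat. 0 < i"]) (auto intro: continuous_on_product_coordinates)
    then show "continuous_map euclidean (euclidean :: cantor topology) (\<lambda>(w :: nat \<Rightarrow> nat) n. 0 < w n)"
      by (simp add: continuous_on_coordinatewise_then_product)
    have "\<beta> = (\<lambda>n. 0 < (if \<beta> n then 1 else 0 :: nat))" for \<beta> :: cantor by (simp add: fun_eq_iff)
    then show "range (\<lambda>(w :: nat \<Rightarrow> nat) n. 0 < w n) = (UNIV :: cantor set)" by (metis surj_def)
  qed
  show "D_space homeomorphic_space subtopology (euclidean :: cantor topology) UNIV"
    using homeomorphic_D_space by simp
qed simp

text \<open>
  Pulling the graph back along \<open>\<alpha> \<mapsto> ((0,\<alpha>),(1,\<alpha>))\<close> gives \<^const>\<open>P_infinity\<close>.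
\<close>
lemma G_graph_not_fsigma: "\<not> fsigma_in (prod_topology D_space D_space) (G_graph \<beta>)"
proof
  assume G: "fsigma_in (prod_topology D_space D_space) (G_graph \<beta>)"
  have "continuous_map euclidean (prod_topology D_space D_space) (\<lambda>\<alpha>. ((False, \<alpha>), (True, \<alpha>)))"
    unfolding prod_topology_euclidean continuous_map_iff_continuous2 by (intro continuous_intros)
  from fsigma_in_continuous_preimage[OF this G]
  have "fsigma_in euclidean {\<alpha>. ((False, \<alpha>), (True, \<alpha>)) \<in> G_graph \<beta>}" by simp
  moreover have "{\<alpha>. ((False, \<alpha>), (True, \<alpha>)) \<in> G_graph \<beta>} = P_infinity"
    by (auto simp: G_graph_iff R_rel_iff)
  ultimately show False using not_fsigma_P_infinity by simp
qed

lemma graph_on_G_graph: "graph_on D_space (G_graph \<beta>)"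
  using R_rel_sym by (auto simp: graph_on_def sym_def G_graph_iff)

lemma locally_countable_G_graph: "locally_countable (G_graph \<beta>)"
proof -
  have *: "countable {q. (p, q) \<in> G_graph \<beta>}" for p
  proof -
    have "{q. (p, q) \<in> G_graph \<beta>} \<subseteq> UNIV \<times> insert (snd p) (- P_infinity)"
      by (auto simp: G_graph_iff R_rel_iff mem_Times_iff)
    then show ?thesis by (rule countable_subset) (use countable_compl_P_infinity in auto)
  qed
  moreover have "sym (G_graph \<beta>)" using graph_on_G_graph by (simp add: graph_on_def)
  then have "{p. (p, q) \<in> G_graph \<beta>} = {p. (q, p) \<in> G_graph \<beta>}" for q
    by (blast dest: symD)
  ultimately show ?thesis by (simp add: locally_countable_def)
qed

lemma borel_G_graph: "G_graph \<beta> \<in> sets borel"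
proof -
  let ?K = "{(p, q) \<in> topspace D_space \<times> topspace D_space. (id p, id q) \<in> G_graph \<beta> \<and> snd (id p) \<notin> P_infinity}"
  let ?C = "{r :: (bool \<times> cantor) \<times> (bool \<times> cantor). fst (fst r) = (\<not> fst (snd r)) \<and> snd (fst r) = snd (snd r)}"
  let ?O = "\<lambda>n. {r :: (bool \<times> cantor) \<times> (bool \<times> cantor). snd (fst r) n \<in> {True}}"
  have "continuous_on UNIV Not" by simp
  then have "continuous_on UNIV (\<lambda>r :: (bool \<times> cantor) \<times> (bool \<times> cantor). \<not> fst (snd r))"
    by (rule continuous_on_compose2) (auto intro!: continuous_intros)
  then have C: "closed ?C"
    by (intro closed_Collect_conj closed_Collect_eq_cantor closed_Collect_eq continuous_intros)
  have O: "open (?O n)" for n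
  proof -
    have "continuous_on UNIV (\<lambda>r :: (bool \<times> cantor) \<times> (bool \<times> cantor). snd (fst r) n)"
      by (rule continuous_on_product_then_coordinatewise) (intro continuous_intros)
    then have "open ((\<lambda>r :: (bool \<times> cantor) \<times> (bool \<times> cantor). snd (fst r) n) -` {True})"
      by (rule open_vimage[rotated]) (simp add: open_discrete)
    then show ?thesis by (simp add: vimage_def)
  qed
  have K: "countable ?K" by (rule countable_off_diagonal) simp
  have "{r} \<in> sets borel" for r :: "(bool \<times> cantor) \<times> (bool \<times> cantor)"
  proof -
    have "metrizable_space D_space" using analytic_D_space by (simp add: analytic_space_def)
    then have "metrizable_space (prod_topology D_space D_space)"
      by (metis metrizable_space_prod_topology)
    then show ?thesis by (intro borel_closed closed_singleton_metrizable) simp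
  qed
  from sets.countable[OF this K] have K: "?K \<in> sets borel" .
  have "(\<Inter>n. \<Union>i\<in>{n..}. ?O i) \<in> sets borel"
  proof (rule sets.countable_INT'')
    show "(\<Union>i\<in>{n..}. ?O i) \<in> sets borel" for n :: nat
      by (rule borel_open, rule open_UN, rule ballI, rule O)
  qed (rule sets.top[of borel, unfolded space_borel], rule countableI_type)
  then have "?C \<inter> (\<Inter>n. \<Union>i\<in>{n..}. ?O i) \<in> sets borel"
    by (rule sets.Int[OF borel_closed[OF C]])
  from sets.Un[OF K this] have "?K \<union> ?C \<inter> (\<Inter>n. \<Union>i\<in>{n..}. ?O i) \<in> sets borel" .
  moreover have "G_graph \<beta> = ?K \<union> ?C \<inter> (\<Inter>n. \<Union>i\<in>{n..}. ?O i)"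
  proof -
    have "\<alpha> \<in> P_infinity \<longleftrightarrow> (\<forall>n. \<exists>i\<in>{n..}. \<alpha> i)" for \<alpha>
      using notin_P_infinity_iff[of \<alpha>] by auto
    then have O: "r \<in> (\<Inter>n. \<Union>i\<in>{n..}. ?O i) \<longleftrightarrow> snd (fst r) \<in> P_infinity" for r by simp
    have C: "r \<in> ?C \<longleftrightarrow> fst (fst r) \<noteq> fst (snd r) \<and> snd (fst r) = snd (snd r)" for r
      by (auto simp: fun_eq_iff)
    have K: "r \<in> ?K \<longleftrightarrow> r \<in> G_graph \<beta> \<and> snd (fst r) \<notin> P_infinity" for r
      by (cases r) simp
    have G: "r \<in> G_graph \<beta> \<longleftrightarrow> fst (fst r) \<noteq> fst (snd r) \<and> (snd (fst r), snd (snd r)) \<in> R_rel \<beta>" for r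
      by (cases r) (simp add: G_graph_iff)
    show ?thesis
    proof (rule set_eqI)
      fix r
      show "r \<in> G_graph \<beta> \<longleftrightarrow> r \<in> ?K \<union> ?C \<inter> (\<Inter>n. \<Union>i\<in>{n..}. ?O i)"
        unfolding Un_iff Int_iff O[of r] C[of r] K[of r] using G[of r] R_rel_iff[of "snd (fst r)" "snd (snd r)" \<beta>]
        by metis
    qed
  qed
  ultimately show ?thesis by (simp only:)
qed

section \<open>Incomparability and the number of graphs\<close>

text \<open>
  Up to a countable set, the diagonal part of the reduction \<open>f\<close> consists of vertical pairs
  \<open>((e,u),(\<not>e,u))\<close> mapped by \<open>f\<close> to \<open>((0,v),(1,v))\<close>, for the two values of \<open>e\<close>; for one \<open>e\<close> these form a
  non-\<open>F\<^sub>\<sigma>\<close> set. The Cantor set theorem for the two maps giving \<open>u\<close> and \<open>v\<close> makes both of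
  them faithful functions of one parameter, whence \<open>R\<^sub>\<beta>\<close> and \<open>R\<^sub>\<beta>\<^sub>'\<close> coincide.
\<close>
lemma G_graph_antichain:
  assumes "\<beta> \<in> N0" "\<beta>' \<in> N0" "embeds_c D_space (G_graph \<beta>) D_space (G_graph \<beta>')"
  shows "\<beta> = \<beta>'"
proof -
  let ?DD = "prod_topology D_space D_space"
  obtain f where f: "continuous_map D_space D_space f" "inj_on f (topspace D_space)"
    and G: "G_graph \<beta> = {(x, y) \<in> topspace D_space \<times> topspace D_space. (f x, f y) \<in> G_graph \<beta>'}"
    using assms(3) unfolding embeds_c_def by blast
  have pull: "(x, y) \<in> G_graph \<beta> \<longleftrightarrow> (f x, f y) \<in> G_graph \<beta>'" for x y unfolding G by simp
  have cf: "continuous_on UNIV f" using f(1) by simp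
  let ?A = "diagonal_part D_space f"
  have metr: "metrizable_space D_space" using analytic_D_space by (simp add: analytic_space_def)
  have A: "\<not> fsigma_in ?DD ?A"
    using diagonal_part_not_fsigma[OF metr f(2) G G_graph_not_fsigma] .
  define Z where "Z e = {r :: (bool \<times> cantor) \<times> (bool \<times> cantor).
     (fst (fst r) = e \<and> fst (snd r) = (\<not> e) \<and> snd (fst r) = snd (snd r)) \<and>
     (fst (f (fst r)) = False \<and> fst (f (snd r)) = True \<and> snd (f (fst r)) = snd (f (snd r)))}" for e
  have cfst: "continuous_on UNIV (\<lambda>r :: (bool \<times> cantor) \<times> (bool \<times> cantor). f (fst r))"
    and csnd: "continuous_on UNIV (\<lambda>r :: (bool \<times> cantor) \<times> (bool \<times> cantor). f (snd r))"
    by (rule continuous_on_compose2[OF cf]; auto intro!: continuous_intros)+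
  have Z: "closedin ?DD (Z e)" for e
  proof -
    have "closed (Z e)" unfolding Z_def
      by (intro closed_Collect_conj closed_Collect_eq_cantor closed_Collect_eq continuous_intros cfst csnd)
    then show ?thesis by simp
  qed
  have Z_iff: "r \<in> Z e \<longleftrightarrow> fst (fst r) = e \<and> fst (snd r) = (\<not> e) \<and> snd (fst r) = snd (snd r) \<and>
     \<not> fst (f (fst r)) \<and> fst (f (snd r)) \<and> snd (f (fst r)) = snd (f (snd r))" for r e
    by (simp add: Z_def fun_eq_iff)
  define h where "h j r = (if j then snd (fst r) else snd (f (fst r)))"
    for j and r :: "(bool \<times> cantor) \<times> (bool \<times> cantor)"
  have h: "continuous_map (subtopology ?DD (Z e)) euclidean (h j)" for e j
  proof (rule continuous_map_from_subtopology)
    have "continuous_on UNIV (\<lambda>r :: (bool \<times> cantor) \<times> (bool \<times> cantor). snd (fst r))"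
      "continuous_on UNIV (\<lambda>r :: (bool \<times> cantor) \<times> (bool \<times> cantor). snd (f (fst r)))"
      by (intro continuous_on_snd continuous_on_fst continuous_on_id cfst)+
    then show "continuous_map ?DD euclidean (h j)"
      by (cases j) (simp_all add: h_def[abs_def])
  qed
  \<comment> \<open>A vertical pair is an edge exactly above \<open>P\<^sub>\<infinity>\<close>, and \<open>f\<close> preserves edges in both directions, so the
  two maps detect the same set.\<close>
  have both: "snd (fst r) \<in> P_infinity \<longleftrightarrow> snd (f (fst r)) \<in> P_infinity" if "r \<in> Z e" for r e
    using pull[of "fst r" "snd r"] that by (cases r) (simp add: Z_iff G_graph_iff R_rel_iff)
  have "\<exists>e. \<not> fsigma_in ?DD (?A \<inter> Z e)"
  proof (rule ccontr)
    let ?K = "{(x, y) \<in> topspace D_space \<times> topspace D_space. (id x, id y) \<in> G_graph \<beta> \<and> snd (id x) \<notin> P_infinity}"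
    assume "\<not> ?thesis"
    moreover have "t1_space ?DD" using metr by (metis metrizable_space_prod_topology metrizable_imp_t1_space)
    then have "fsigma_in ?DD (?A \<inter> ?K)"
      using countable_subset[OF _ countable_off_diagonal[of id D_space \<beta>], of "?A \<inter> ?K"] metr
      by (intro fsigma_in_countable) auto
    ultimately have "fsigma_in ?DD (?A \<inter> Z False \<union> ?A \<inter> Z True \<union> ?A \<inter> ?K)"
      by (intro fsigma_in_Un) auto
    moreover have "?A \<inter> Z False \<union> ?A \<inter> Z True \<union> ?A \<inter> ?K = ?A"
    proof -
      have "(x, y) \<in> Z False \<union> Z True \<union> ?K" if "(x, y) \<in> ?A" for x y
      proof -
        have "(x, y) \<in> G_graph \<beta>" using that pull by (auto simp: diagonal_part_def G_graph_iff R_rel_iff)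
        then show ?thesis using that by (auto simp: diagonal_part_def Z_iff G_graph_iff R_rel_iff)
      qed
      then show ?thesis by blast
    qed
    ultimately show False using A by simp
  qed
  then obtain e where e: "\<not> fsigma_in ?DD (?A \<inter> Z e)" by blast
  obtain k where k: "\<And>\<alpha>. k \<alpha> \<in> Z e" and faithful: "\<And>j. faithful (\<lambda>\<alpha>. h j (k \<alpha>))"
  proof (rule cantor_copy_in_square[where h = h, OF analytic_D_space Z h _ _ e])
    show "h j r \<in> P_infinity \<longleftrightarrow> r \<in> ?A \<inter> Z e" if "r \<in> Z e" for j r
      using both[OF that] that by (auto simp: h_def diagonal_part_def Z_iff)
  qed auto
  define u v where "u \<alpha> = snd (fst (k \<alpha>))" and "v \<alpha> = snd (f (fst (k \<alpha>)))" for \<alpha>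
  have uv: "faithful u" "faithful v"
    using faithful[of True] faithful[of False] by (simp_all add: h_def u_def[abs_def] v_def[abs_def])
  have R: "(x, y) \<in> R_rel \<beta> \<longleftrightarrow> (x, y) \<in> R_rel \<beta>'" for x y
  proof -
    have "(u x, u y) \<in> R_rel \<beta> \<longleftrightarrow> (v x, v y) \<in> R_rel \<beta>'"
      using pull[of "fst (k x)" "snd (k y)"] k[of x] k[of y]
      unfolding G_graph_iff Z_iff u_def v_def by metis
    then show ?thesis by (simp add: faithful_R_rel[OF uv(1)] faithful_R_rel[OF uv(2)])
  qed
  show ?thesis
  proof
    fix p
    show "\<beta> p = \<beta>' p"
    proof (cases "p = 0")
      case True
      then show ?thesis using assms(1,2) by (simp add: N0_def)
    next
      case False
      then obtain z t where zt: "z \<in> Q" "t \<in> Q" "z \<noteq> t" "idx z t = p" using idx_surj by blast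
      then show ?thesis using R[of "zeros_ext z" "zeros_ext t"]
        by (simp add: R_rel_iff trunc_zeros_ext zeros_ext_eq_iff)
    qed
  qed
qed

lemma embeds_c_refl: "R \<subseteq> topspace X \<times> topspace X \<Longrightarrow> embeds_c X R X R"
  unfolding embeds_c_def by (intro exI[of _ id]) auto

lemma N0_eqpoll: "N0 \<approx> (UNIV :: real set)"
proof -
  have "bij_betw (\<lambda>\<beta>. {n. \<beta> (Suc n)}) N0 UNIV"
    by (rule bij_betw_byWitness[where f' = "\<lambda>S. case_nat False (\<lambda>n. n \<in> S)"])
      (auto simp: N0_def fun_eq_iff split: nat.split)
  then have "N0 \<approx> (UNIV :: nat set set)" by (auto simp: eqpoll_def)
  then show ?thesis using nat_sets_eqpoll_reals eqpoll_trans by blast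
qed

theorem corollary3p13:
  shows
    "(\<forall>\<beta> \<in> N0.
        graph_on D_space (G_graph \<beta>) \<and>
        locally_countable (G_graph \<beta>) \<and>
        G_graph \<beta> \<in> sets borel \<and>
        minimal_non_Sigma02_graph TYPE('a) D_space (G_graph \<beta>)) \<and>
     (\<forall>\<beta> \<in> N0. \<forall>\<beta>' \<in> N0. \<beta> \<noteq> \<beta>' \<longrightarrow>
        \<not> embeds_c D_space (G_graph \<beta>) D_space (G_graph \<beta>') \<and>
        \<not> embeds_c D_space (G_graph \<beta>') D_space (G_graph \<beta>)) \<and>
     (\<lambda>\<beta>. (D_space, G_graph \<beta>)) ` N0 \<approx> (UNIV :: real set)"
proof (intro conjI ballI impI)
  fix \<beta> \<beta>' assume b: "\<beta> \<in> N0" "\<beta>' \<in> N0" "\<beta> \<noteq> \<beta>'"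
  show "\<not> embeds_c D_space (G_graph \<beta>) D_space (G_graph \<beta>')" "\<not> embeds_c D_space (G_graph \<beta>') D_space (G_graph \<beta>)"
    using G_graph_antichain b by metis+
next
  fix \<beta>
  show "minimal_non_Sigma02_graph TYPE('a) D_space (G_graph \<beta>)"
    using G_graph_minimal analytic_D_space graph_on_G_graph G_graph_not_fsigma
    unfolding minimal_non_Sigma02_graph_def non_Sigma02_graph_def by blast
next
  have "inj_on (\<lambda>\<beta>. (D_space, G_graph \<beta>)) N0"
  proof (rule inj_onI)
    fix \<beta> \<beta>' assume b: "\<beta> \<in> N0" "\<beta>' \<in> N0" "(D_space, G_graph \<beta>) = (D_space, G_graph \<beta>')"
    then show "\<beta> = \<beta>'" using G_graph_antichain embeds_c_refl[of "G_graph \<beta>" D_space] by simp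
  qed
  then show "(\<lambda>\<beta>. (D_space, G_graph \<beta>)) ` N0 \<approx> (UNIV :: real set)"
    using inj_on_image_eqpoll_self N0_eqpoll eqpoll_trans by blast
qed (use graph_on_G_graph locally_countable_G_graph borel_G_graph in auto)

end
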